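(* Let $D\ge 2$, $q\ge 0$, and let $i\in\{0,\dots,D\}$ be a color, with $i\ne 0$ if $q>0$. The map $$\Psi^{(i)}:\ \mathbb{G}^q_D\to \mathbb{S}^q_{D-1},\qquad G\mapsto \Psi\bigl(G^{\hat i},\Omega^{(i)}(G)\bigr)$$ is a bijection (between isomorphism classes), where $\mathbb{S}^q_{D-1}$ is the set of connected stacked maps with color set $\{0,\dots,D\}\setminus\{i\}$ and $q$ marked corners on $q$ different color-$0$ vertices.
   Context: $\mathbb{G}^q_D$: connected finite bipartite (black/white) edge-colored graphs (multiple edges allowed) in which every vertex is incident to exactly one edge of each color in $\{0,\dots,D\}$, except for $q$ white and $q$ black vertices which have exactly one incident edge of each color in $\{1,\dots,D\}$ and none of color $0$. $G^{\hat i}$ is obtained from $G$ by deleting all color-$i$ edges. $\Omega^{(i)}(G)$ is the pairing (partition of the vertices into black–white pairs) whose pairs are the pairs of endpoints of the color-$i$ edges of $G$. Canonical addition of marked edges: given a pairing $\Omega$, each vertex with no color-$0$ edge is the endpoint of a unique path alternating pairs of $\Omega$ and color-$0$ edges, whose other endpoint is also a vertex without color-$0$ edge; one adds a marked color-$0$ edge between the two endpoints of each of these $q$ paths. When applying $\Psi$ to a graph with missing color-$0$ edges, these marked edges are added first. Stacked maps (with a color set $C$): objects with white vertices, colored vertices, and colored edges; an edge of color $c\in C$ joins a white vertex to a vertex of color $c$; each white vertex is incident to exactly one edge of each color of $C$, with no ordering; a color-$c$ vertex is incident only to color-$c$ edges, which are cyclically ordered around it. Some corners (pairs of consecutive edges)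 at color-$0$ vertices may be marked, at most one per vertex. Definition of $\Psi$: for a graph $G'$ (bipartite, one edge of each color of $C$ at each vertex, some color-$0$ edges marked) and a pairing $\Omega$ of its vertices, let $\sigma_c$ be the permutation of the set of pairs with $\sigma_c(\pi)=\pi'$ if the color-$c$ edge incident to the black vertex of $\pi$ ends at the white vertex of $\pi'$. $\Psi(G',\Omega)$ has one white vertex per pair and, for each $c\in C$ and each cycle of $\sigma_c$, a color-$c$ vertex joined by color-$c$ edges to the pairs in the cycle, in the cyclic (counterclockwise) order given by $\sigma_c$; corners correspond to edges of $G'$, and marked color-$0$ edges give marked corners. *)

theory Defs
  imports
    "Graph_Theory.Digraph_Component"
    "HOL-Combinatorics.Orbits"
    "HOL-Library.FuncSet"
    "HOL-Library.Infinite_Typeclass"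
begin

section \<open>Edge-coloured bipartite graphs\<close>

text \<open>
  A bipartite multigraph with an explicit edge set, so that parallel edges are allowed.
  The fields \<open>bend\<close> and \<open>wend\<close> give the black and the white endpoint of an edge.
\<close>

record ('v, 'e) cgraph =
  black :: "'v set"
  white :: "'v set"
  edges :: "'e set"
  bend :: "'e \<Rightarrow> 'v"
  wend :: "'e \<Rightarrow> 'v"
  colour :: "'e \<Rightarrow> nat"

definition incident :: "('v, 'e, 'x) cgraph_scheme \<Rightarrow> 'v \<Rightarrow> 'e \<Rightarrow> bool" where
  "incident G v e \<longleftrightarrow> e \<in> edges G \<and> (bend G e = v \<or> wend G e = v)"

definition missing :: "('v, 'e, 'x) cgraph_scheme \<Rightarrow> nat \<Rightarrow> 'v \<Rightarrow> bool" where
  "missing G c v \<longleftrightarrow> \<not> (\<exists>e. incident G v e \<and> colour G e = c)"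

text \<open>
  The orientation from black to white is irrelevant here: \<^const>\<open>Digraph_Component.connected\<close>
  symmetrises the arcs. It also requires at least one vertex.
\<close>

definition cgraph_connected :: "('v, 'e, 'x) cgraph_scheme \<Rightarrow> bool" where
  "cgraph_connected G \<longleftrightarrow> Digraph_Component.connected
     \<lparr>verts = black G \<union> white G, arcs = edges G, tail = bend G, head = wend G\<rparr>"

definition coloured_graphs :: "nat \<Rightarrow> nat \<Rightarrow> ('v, 'e) cgraph set" where
  "coloured_graphs q D = {G.
     finite (black G) \<and> finite (white G) \<and> finite (edges G) \<and>
     black G \<inter> white G = {} \<and>
     (\<forall>e\<in>edges G. bend G e \<in> black G \<and> wend G e \<in> white G \<and> colour G e \<in> {0..D}) \<and>
     (\<exists>B W. B \<subseteq> black G \<and> W \<subseteq> white G \<and> card B = q \<and> card W = q \<and>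
        (\<forall>v \<in> black G \<union> white G. \<forall>c\<in>{0..D}.
           if c = 0 \<and> v \<in> B \<union> W then missing G c v
           else \<exists>!e. incident G v e \<and> colour G e = c)) \<and>
     cgraph_connected G}"

definition cgraph_isomorphic ::
    "('v, 'e) cgraph \<Rightarrow> ('v2, 'e2) cgraph \<Rightarrow> bool" where
  "cgraph_isomorphic G H \<longleftrightarrow> (\<exists>f g.
     bij_betw f (black G \<union> white G) (black H \<union> white H) \<and>
     f ` black G = black H \<and> f ` white G = white H \<and>
     bij_betw g (edges G) (edges H) \<and>
     (\<forall>e\<in>edges G. bend H (g e) = f (bend G e) \<and> wend H (g e) = f (wend G e) \<and>
        colour H (g e) = colour G e))"

definition cgraph_iso_rel :: "nat \<Rightarrow> nat \<Rightarrow> (('v, 'e) cgraph \<times> ('v, 'e) cgraph) set" where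
  "cgraph_iso_rel q D =
     {(G, H). G \<in> coloured_graphs q D \<and> H \<in> coloured_graphs q D \<and> cgraph_isomorphic G H}"

definition delete_colour :: "nat \<Rightarrow> ('v, 'e) cgraph \<Rightarrow> ('v, 'e) cgraph" where
  "delete_colour i G = G\<lparr>edges := {e \<in> edges G. colour G e \<noteq> i}\<rparr>"

text \<open>A pair of a pairing is written as an ordered pair (black vertex, white vertex).\<close>

definition colour_pairing :: "nat \<Rightarrow> ('v, 'e) cgraph \<Rightarrow> ('v \<times> 'v) set" where
  "colour_pairing i G = {(bend G e, wend G e) | e. e \<in> edges G \<and> colour G e = i}"


section \<open>Canonical addition of marked edges\<close>

text \<open>
  \<open>alternating_path G \<Omega> b w\<close>: there is a path from the black vertex \<open>b\<close> to the white vertex \<open>w\<close>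
  that starts and ends with a pair of \<open>\<Omega>\<close> and alternates pairs of \<open>\<Omega>\<close> and edges of colour 0.
  Such a path traverses pairs from black to white and edges of colour 0 from white to black.
\<close>

inductive alternating_path :: "('v, 'e) cgraph \<Rightarrow> ('v \<times> 'v) set \<Rightarrow> 'v \<Rightarrow> 'v \<Rightarrow> bool"
  for G :: "('v, 'e) cgraph" and \<Omega> :: "('v \<times> 'v) set" where
  pair: "(b, w) \<in> \<Omega> \<Longrightarrow> alternating_path G \<Omega> b w"
| step: "\<lbrakk>alternating_path G \<Omega> b w; e \<in> edges G; colour G e = 0; wend G e = w;
          (bend G e, w') \<in> \<Omega>\<rbrakk> \<Longrightarrow> alternating_path G \<Omega> b w'"

definition open_path_ends :: "('v, 'e) cgraph \<Rightarrow> ('v \<times> 'v) set \<Rightarrow> ('v \<times> 'v) set" where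
  "open_path_ends G \<Omega> = {(b, w). b \<in> black G \<and> w \<in> white G \<and> missing G 0 b \<and> missing G 0 w \<and>
     alternating_path G \<Omega> b w}"

record ('v, 'e) marked_cgraph = "('v, 'e) cgraph" +
  marked_edges :: "'e set"

text \<open>
  An added edge is named by its pair of endpoints, in the right summand of the new edge type.
  If 0 is not in the colour set \<open>C\<close>, no colour-0 edge counts as missing and nothing is added.
\<close>

definition add_marked_edges ::
    "nat set \<Rightarrow> ('v, 'e) cgraph \<Rightarrow> ('v \<times> 'v) set \<Rightarrow> ('v, 'e + 'v \<times> 'v) marked_cgraph" where
  "add_marked_edges C G \<Omega> =
     (let N = (if 0 \<in> C then Inr ` open_path_ends G \<Omega> else {}) in
      \<lparr>black = black G, white = white G, edges = Inl ` edges G \<union> N,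
       bend = case_sum (bend G) fst, wend = case_sum (wend G) snd,
       colour = case_sum (colour G) (\<lambda>_. 0), marked_edges = N\<rparr>)"


section \<open>Stacked maps\<close>

text \<open>
  The permutation \<open>rot\<close> sends an edge to the next one counterclockwise around its coloured vertex.
  A corner is the ordered pair \<open>(e, rot e)\<close> of consecutive edges; a vertex of degree 1 has the
  single corner \<open>(e, e)\<close>, a vertex of degree 2 has two corners.
\<close>

record ('w, 'n, 'm) smap =
  whites :: "'w set"
  cverts :: "'n set"
  medges :: "'m set"
  vcol :: "'n \<Rightarrow> nat"
  ecol :: "'m \<Rightarrow> nat"
  w_end :: "'m \<Rightarrow> 'w"
  c_end :: "'m \<Rightarrow> 'n"
  rot :: "'m \<Rightarrow> 'm"
  marked_corners :: "('m \<times> 'm) set"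

text \<open>
  The \<^const>\<open>cyclic_on\<close> condition makes \<open>rot\<close> a single cycle on the edges around each coloured
  vertex; in particular a coloured vertex has at least one edge.
\<close>

definition stacked_map :: "nat set \<Rightarrow> ('w, 'n, 'm) smap \<Rightarrow> bool" where
  "stacked_map C M \<longleftrightarrow>
     finite (whites M) \<and> finite (cverts M) \<and> finite (medges M) \<and>
     (\<forall>v\<in>cverts M. vcol M v \<in> C) \<and>
     (\<forall>e\<in>medges M. w_end M e \<in> whites M \<and> c_end M e \<in> cverts M \<and>
        vcol M (c_end M e) = ecol M e) \<and>
     (\<forall>w\<in>whites M. \<forall>c\<in>C. \<exists>!e. e \<in> medges M \<and> w_end M e = w \<and> ecol M e = c) \<and>
     (\<forall>v\<in>cverts M. cyclic_on (rot M) {e \<in> medges M. c_end M e = v}) \<and>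
     marked_corners M \<subseteq> {(e, rot M e) | e. e \<in> medges M \<and> vcol M (c_end M e) = 0} \<and>
     inj_on (\<lambda>(e, e'). c_end M e) (marked_corners M)"

definition smap_connected :: "('w, 'n, 'm) smap \<Rightarrow> bool" where
  "smap_connected M \<longleftrightarrow> Digraph_Component.connected
     \<lparr>verts = Inl ` whites M \<union> Inr ` cverts M, arcs = medges M,
      tail = Inl \<circ> w_end M, head = Inr \<circ> c_end M\<rparr>"

definition stacked_maps :: "nat \<Rightarrow> nat set \<Rightarrow> ('w, 'n, 'm) smap set" where
  "stacked_maps q C = {M. stacked_map C M \<and> smap_connected M \<and> card (marked_corners M) = q}"

definition smap_isomorphic ::
    "('w, 'n, 'm) smap \<Rightarrow> ('w2, 'n2, 'm2) smap \<Rightarrow> bool" where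
  "smap_isomorphic M N \<longleftrightarrow> (\<exists>f g h.
     bij_betw f (whites M) (whites N) \<and>
     bij_betw g (cverts M) (cverts N) \<and>
     bij_betw h (medges M) (medges N) \<and>
     (\<forall>v\<in>cverts M. vcol N (g v) = vcol M v) \<and>
     (\<forall>e\<in>medges M. w_end N (h e) = f (w_end M e) \<and> c_end N (h e) = g (c_end M e) \<and>
        ecol N (h e) = ecol M e \<and> rot N (h e) = h (rot M e)) \<and>
     map_prod h h ` marked_corners M = marked_corners N)"

definition smap_iso_rel ::
    "nat \<Rightarrow> nat set \<Rightarrow> (('w, 'n, 'm) smap \<times> ('w, 'n, 'm) smap) set" where
  "smap_iso_rel q C =
     {(M, N). M \<in> stacked_maps q C \<and> N \<in> stacked_maps q C \<and> smap_isomorphic M N}"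


section \<open>The map from coloured graphs to stacked maps\<close>

definition pair_perm ::
    "('v, 'e, 'x) cgraph_scheme \<Rightarrow> ('v \<times> 'v) set \<Rightarrow> nat \<Rightarrow> 'v \<times> 'v \<Rightarrow> 'v \<times> 'v" where
  "pair_perm G \<Omega> c \<pi> = (THE \<pi>'. \<pi>' \<in> \<Omega> \<and>
     (\<exists>e\<in>edges G. colour G e = c \<and> bend G e = fst \<pi> \<and> wend G e = snd \<pi>'))"

text \<open>
  The edge of colour \<open>c\<close> at the white vertex \<open>\<pi>\<close> is \<open>(c, \<pi>)\<close>, and a coloured vertex is a
  colour together with the set of pairs on a cycle. The colour-\<open>c\<close> edge of \<open>G\<close> leaving the black
  vertex of \<open>\<pi>\<close> corresponds to the corner from \<open>(c, \<pi>)\<close> to its successor.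
\<close>

definition Psi_marked ::
    "nat set \<Rightarrow> ('v, 'e) marked_cgraph \<Rightarrow> ('v \<times> 'v) set \<Rightarrow>
     ('v \<times> 'v, nat \<times> ('v \<times> 'v) set, nat \<times> ('v \<times> 'v)) smap" where
  "Psi_marked C G \<Omega> = (let \<sigma> = pair_perm G \<Omega> in
     \<lparr>whites = \<Omega>,
      cverts = {(c, orbit (\<sigma> c) \<pi>) | c \<pi>. c \<in> C \<and> \<pi> \<in> \<Omega>},
      medges = C \<times> \<Omega>,
      vcol = fst,
      ecol = fst,
      w_end = snd,
      c_end = (\<lambda>(c, \<pi>). (c, orbit (\<sigma> c) \<pi>)),
      rot = (\<lambda>(c, \<pi>). (c, \<sigma> c \<pi>)),
      marked_corners = {((0, \<pi>), (0, \<sigma> 0 \<pi>)) | \<pi>.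
        \<pi> \<in> \<Omega> \<and> (\<exists>e\<in>marked_edges G. bend G e = fst \<pi>)}\<rparr>)"

definition Psi ::
    "nat set \<Rightarrow> ('v, 'e) cgraph \<Rightarrow> ('v \<times> 'v) set \<Rightarrow>
     ('v \<times> 'v, nat \<times> ('v \<times> 'v) set, nat \<times> ('v \<times> 'v)) smap" where
  "Psi C G \<Omega> = Psi_marked C (add_marked_edges C G \<Omega>) \<Omega>"

definition Psi_colour ::
    "nat \<Rightarrow> nat \<Rightarrow> ('v, 'e) cgraph \<Rightarrow>
     ('v \<times> 'v, nat \<times> ('v \<times> 'v) set, nat \<times> ('v \<times> 'v)) smap" where
  "Psi_colour D i G = Psi ({0..D} - {i}) (delete_colour i G) (colour_pairing i G)"


section \<open>Isomorphism is an equivalence relation\<close>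

lemma cgraph_isomorphic_refl: "cgraph_isomorphic G G"
  unfolding cgraph_isomorphic_def by (intro exI[of _ id]) simp

lemma cgraph_isomorphic_sym:
  assumes wf: "\<forall>e\<in>edges G. bend G e \<in> black G \<and> wend G e \<in> white G"
    and iso: "cgraph_isomorphic G H"
  shows "cgraph_isomorphic H G"
proof -
  from iso obtain f g where f: "bij_betw f (black G \<union> white G) (black H \<union> white H)"
    and fb: "f ` black G = black H" and fw: "f ` white G = white H"
    and g: "bij_betw g (edges G) (edges H)"
    and e: "\<forall>e\<in>edges G. bend H (g e) = f (bend G e) \<and> wend H (g e) = f (wend G e) \<and>
        colour H (g e) = colour G e"
    unfolding cgraph_isomorphic_def by blast
  define f' where "f' = inv_into (black G \<union> white G) f"
  define g' where "g' = inv_into (edges G) g"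
  have f'f: "f' (f v) = v" if "v \<in> black G \<union> white G" for v
    unfolding f'_def using f that by (meson bij_betw_inv_into_left)
  have g'g: "g' (g x) = x" if "x \<in> edges G" for x
    unfolding g'_def using g that by (meson bij_betw_inv_into_left)
  have "bij_betw f' (black H \<union> white H) (black G \<union> white G)" "bij_betw g' (edges H) (edges G)"
    unfolding f'_def g'_def using f g bij_betw_inv_into by blast+
  moreover have "f' ` black H = black G" "f' ` white H = white G"
    unfolding fb[symmetric] fw[symmetric] image_image using f'f by simp_all
  moreover have "bend G (g' x) = f' (bend H x) \<and> wend G (g' x) = f' (wend H x) \<and>
      colour G (g' x) = colour H x" if "x \<in> edges H" for x
  proof -
    obtain y where y: "y \<in> edges G" "x = g y"
      using g \<open>x \<in> edges H\<close> by (auto simp: bij_betw_def)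
    then show ?thesis using e wf f'f g'g by simp
  qed
  ultimately show ?thesis unfolding cgraph_isomorphic_def by blast
qed

lemma cgraph_isomorphic_trans:
  assumes wf: "\<forall>e\<in>edges G. bend G e \<in> black G \<and> wend G e \<in> white G"
    and "cgraph_isomorphic G H" "cgraph_isomorphic H K"
  shows "cgraph_isomorphic G K"
proof -
  from assms(2) obtain f g where 1: "bij_betw f (black G \<union> white G) (black H \<union> white H)"
    "f ` black G = black H" "f ` white G = white H" "bij_betw g (edges G) (edges H)"
    "\<forall>e\<in>edges G. bend H (g e) = f (bend G e) \<and> wend H (g e) = f (wend G e) \<and>
        colour H (g e) = colour G e"
    unfolding cgraph_isomorphic_def by blast
  from assms(3) obtain f' g' where 2: "bij_betw f' (black H \<union> white H) (black K \<union> white K)"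
    "f' ` black H = black K" "f' ` white H = white K" "bij_betw g' (edges H) (edges K)"
    "\<forall>e\<in>edges H. bend K (g' e) = f' (bend H e) \<and> wend K (g' e) = f' (wend H e) \<and>
        colour K (g' e) = colour H e"
    unfolding cgraph_isomorphic_def by blast
  have gH: "g e \<in> edges H" if "e \<in> edges G" for e
    using 1(4) that by (auto simp: bij_betw_def)
  show ?thesis unfolding cgraph_isomorphic_def
  proof (intro exI[of _ "f' \<circ> f"] exI[of _ "g' \<circ> g"] conjI ballI)
    show "bij_betw (f' \<circ> f) (black G \<union> white G) (black K \<union> white K)"
      using bij_betw_trans[OF 1(1) 2(1)] .
    show "bij_betw (g' \<circ> g) (edges G) (edges K)" using bij_betw_trans[OF 1(4) 2(4)] .
    show "(f' \<circ> f) ` black G = black K" "(f' \<circ> f) ` white G = white K"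
      by (simp_all only: image_comp[symmetric] 1(2,3) 2(2,3))
  qed (use 1(5) 2(5) gH in auto)
qed

lemma coloured_graphs_ends:
  "G \<in> coloured_graphs q D \<Longrightarrow> \<forall>e\<in>edges G. bend G e \<in> black G \<and> wend G e \<in> white G"
  by (auto simp: coloured_graphs_def)

lemma equiv_cgraph_iso_rel: "equiv (coloured_graphs q D) (cgraph_iso_rel q D)"
proof (rule equivI)
  show "cgraph_iso_rel q D \<subseteq> coloured_graphs q D \<times> coloured_graphs q D"
    by (auto simp: cgraph_iso_rel_def)
  show "refl_on (coloured_graphs q D) (cgraph_iso_rel q D)"
    by (auto simp: refl_on_def cgraph_iso_rel_def cgraph_isomorphic_refl)
  show "sym (cgraph_iso_rel q D)"
  proof (rule symI)
    fix G H assume "(G, H) \<in> cgraph_iso_rel q D"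
    then show "(H, G) \<in> cgraph_iso_rel q D"
      using cgraph_isomorphic_sym[OF coloured_graphs_ends, of G q D H] by (auto simp: cgraph_iso_rel_def)
  qed
  show "trans (cgraph_iso_rel q D)"
  proof (rule transI)
    fix G H K assume "(G, H) \<in> cgraph_iso_rel q D" "(H, K) \<in> cgraph_iso_rel q D"
    then show "(G, K) \<in> cgraph_iso_rel q D"
      using cgraph_isomorphic_trans[OF coloured_graphs_ends, of G q D H K] by (auto simp: cgraph_iso_rel_def)
  qed
qed

lemma stacked_map_rot:
  assumes "stacked_map C M" "e \<in> medges M"
  shows "rot M e \<in> medges M"
proof -
  have "cyclic_on (rot M) {x \<in> medges M. c_end M x = c_end M e}"
    using assms unfolding stacked_map_def by blast
  then show ?thesis using assms(2) cyclic_on_inI by fastforce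
qed

lemma smap_isomorphic_refl: "smap_isomorphic M M"
  unfolding smap_isomorphic_def by (intro exI[of _ id]) (simp add: map_prod.id)

lemma smap_isomorphic_sym:
  assumes M: "stacked_map C M" and iso: "smap_isomorphic M N"
  shows "smap_isomorphic N M"
proof -
  from iso obtain f g h where f: "bij_betw f (whites M) (whites N)"
    and g: "bij_betw g (cverts M) (cverts N)" and h: "bij_betw h (medges M) (medges N)"
    and v: "\<forall>v\<in>cverts M. vcol N (g v) = vcol M v"
    and e: "\<forall>e\<in>medges M. w_end N (h e) = f (w_end M e) \<and> c_end N (h e) = g (c_end M e) \<and>
        ecol N (h e) = ecol M e \<and> rot N (h e) = h (rot M e)"
    and m: "map_prod h h ` marked_corners M = marked_corners N"
    unfolding smap_isomorphic_def by blast
  define f' where "f' = inv_into (whites M) f"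
  define g' where "g' = inv_into (cverts M) g"
  define h' where "h' = inv_into (medges M) h"
  have f'f: "f' (f x) = x" if "x \<in> whites M" for x
    unfolding f'_def using f that by (meson bij_betw_inv_into_left)
  have g'g: "g' (g x) = x" if "x \<in> cverts M" for x
    unfolding g'_def using g that by (meson bij_betw_inv_into_left)
  have h'h: "h' (h x) = x" if "x \<in> medges M" for x
    unfolding h'_def using h that by (meson bij_betw_inv_into_left)
  have inc: "w_end M x \<in> whites M" "c_end M x \<in> cverts M" if "x \<in> medges M" for x
    using M that by (auto simp: stacked_map_def)
  have "bij_betw f' (whites N) (whites M)" "bij_betw g' (cverts N) (cverts M)"
    "bij_betw h' (medges N) (medges M)"
    unfolding f'_def g'_def h'_def using f g h bij_betw_inv_into by blast+
  moreover have "vcol M (g' y) = vcol N y" if "y \<in> cverts N" for y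
    proof -
    obtain x where "x \<in> cverts M" "y = g x"
      using g \<open>y \<in> cverts N\<close> by (auto simp: bij_betw_def)
    then show ?thesis using v g'g by simp
  qed
  moreover have "w_end M (h' y) = f' (w_end N y) \<and> c_end M (h' y) = g' (c_end N y) \<and>
      ecol M (h' y) = ecol N y \<and> rot M (h' y) = h' (rot N y)" if "y \<in> medges N" for y
  proof -
    obtain x where x: "x \<in> medges M" "y = h x"
      using h \<open>y \<in> medges N\<close> by (auto simp: bij_betw_def)
    then show ?thesis using e f'f g'g h'h inc stacked_map_rot[OF M] by simp
  qed
  moreover have "map_prod h' h' ` marked_corners N = marked_corners M"
  proof -
    have "map_prod h' h' (map_prod h h p) = p" if "p \<in> marked_corners M" for p
    proof -
      have "p \<in> {(e, rot M e) | e. e \<in> medges M \<and> vcol M (c_end M e) = 0}"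
        using M that unfolding stacked_map_def by blast
      then show ?thesis using h'h stacked_map_rot[OF M] by auto
    qed
    then show ?thesis unfolding m[symmetric] image_image by simp
  qed
  ultimately show ?thesis unfolding smap_isomorphic_def by blast
qed

lemma smap_isomorphic_trans:
  assumes M: "stacked_map C M" and "smap_isomorphic M N" "smap_isomorphic N K"
  shows "smap_isomorphic M K"
proof -
  from assms(2) obtain f g h where 1: "bij_betw f (whites M) (whites N)"
    "bij_betw g (cverts M) (cverts N)" "bij_betw h (medges M) (medges N)"
    "\<forall>v\<in>cverts M. vcol N (g v) = vcol M v"
    "\<forall>e\<in>medges M. w_end N (h e) = f (w_end M e) \<and> c_end N (h e) = g (c_end M e) \<and>
        ecol N (h e) = ecol M e \<and> rot N (h e) = h (rot M e)"
    "map_prod h h ` marked_corners M = marked_corners N"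
    unfolding smap_isomorphic_def by blast
  from assms(3) obtain f' g' h' where 2: "bij_betw f' (whites N) (whites K)"
    "bij_betw g' (cverts N) (cverts K)" "bij_betw h' (medges N) (medges K)"
    "\<forall>v\<in>cverts N. vcol K (g' v) = vcol N v"
    "\<forall>e\<in>medges N. w_end K (h' e) = f' (w_end N e) \<and> c_end K (h' e) = g' (c_end N e) \<and>
        ecol K (h' e) = ecol N e \<and> rot K (h' e) = h' (rot N e)"
    "map_prod h' h' ` marked_corners N = marked_corners K"
    unfolding smap_isomorphic_def by blast
  have hN: "h e \<in> medges N" if "e \<in> medges M" for e
    using 1(3) that by (auto simp: bij_betw_def)
  have gN: "g v \<in> cverts N" if "v \<in> cverts M" for v
    using 1(2) that by (auto simp: bij_betw_def)
  show ?thesis unfolding smap_isomorphic_def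
  proof (intro exI[of _ "f' \<circ> f"] exI[of _ "g' \<circ> g"] exI[of _ "h' \<circ> h"] conjI ballI)
    show "bij_betw (f' \<circ> f) (whites M) (whites K)" using bij_betw_trans[OF 1(1) 2(1)] .
    show "bij_betw (g' \<circ> g) (cverts M) (cverts K)" using bij_betw_trans[OF 1(2) 2(2)] .
    show "bij_betw (h' \<circ> h) (medges M) (medges K)" using bij_betw_trans[OF 1(3) 2(3)] .
    show "map_prod (h' \<circ> h) (h' \<circ> h) ` marked_corners M = marked_corners K"
      unfolding 2(6)[symmetric] 1(6)[symmetric] by (simp add: image_comp map_prod.comp)
  qed (use 1(4,5) 2(4,5) hN gN in auto)
qed

lemma stacked_mapsD: "M \<in> stacked_maps q C \<Longrightarrow> stacked_map C M"
  by (simp add: stacked_maps_def)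

lemma equiv_smap_iso_rel: "equiv (stacked_maps q C) (smap_iso_rel q C)"
proof (rule equivI)
  show "smap_iso_rel q C \<subseteq> stacked_maps q C \<times> stacked_maps q C"
    by (auto simp: smap_iso_rel_def)
  show "refl_on (stacked_maps q C) (smap_iso_rel q C)"
    by (auto simp: refl_on_def smap_iso_rel_def smap_isomorphic_refl)
  show "sym (smap_iso_rel q C)"
  proof (rule symI)
    fix G H assume "(G, H) \<in> smap_iso_rel q C"
    then show "(H, G) \<in> smap_iso_rel q C"
      using smap_isomorphic_sym[OF stacked_mapsD, of G q C H] by (auto simp: smap_iso_rel_def)
  qed
  show "trans (smap_iso_rel q C)"
  proof (rule transI)
    fix G H K assume "(G, H) \<in> smap_iso_rel q C" "(H, K) \<in> smap_iso_rel q C"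
    then show "(G, K) \<in> smap_iso_rel q C"
      using smap_isomorphic_trans[OF stacked_mapsD, of G q C H K] by (auto simp: smap_iso_rel_def)
  qed
qed

end

theory Submission
  imports Defs
begin

text \<open>
  Contracting the pairs of colour \<open>i\<close> turns a coloured graph into a family of partial injections of
  the set of pairs, one for each remaining colour, and only colour 0 can have gaps. A partial injection
  of a finite set splits into cycles and paths; the marked edges close every path to a cycle, and since
  each resulting cycle contains at most one marked edge, erasing the marked edges loses no information.
  A stacked map is likewise, up to isomorphism, a family of permutations of its white vertices with
  at most one mark on every cycle of colour 0, so both kinds of objects are encoded by the same data.
\<close>

section \<open>Orbits of self-bijections of a finite set\<close>

text \<open>Connectedness speaks of undirected walks in a graph on one side and in a map on the
  other. Both are restated through cuts. On a finite set a subset closed under a permutation is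
  closed under its inverse, so either notion becomes transitivity of the family of permutations: no
  proper nonempty subset is invariant under all of them. Adding marked edges does not disturb this,
  since such an edge joins two ends of one alternating path and merges no components. Isomorphisms
  are compared before closing up. The closure is determined by the partial injection, so a bijection
  of pairs that respects the unmarked steps also respects the completed permutations. The resulting
  equivalence between isomorphism of graphs and isomorphism of their images gives well-definedness
  on classes and injectivity at once; surjectivity is a separate realisation of given data by a
  graph. The condition on \<open>i\<close> makes the edges of colour \<open>i\<close> cover every
  vertex, so that the pairs retain all of the graph.\<close>

lemma orbit_subset_closed:
  assumes "f ` A \<subseteq> A" "x \<in> A"
  shows "orbit f x \<subseteq> A"
proof
  fix y assume "y \<in> orbit f x"
  then show "y \<in> A" by (induction) (use assms in auto)
qed

text \<open>The set \<open>orbit f x\<close> is generated from \<open>f x\<close>, not from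
  \<open>x\<close>, so finiteness is what brings \<open>x\<close> back. The injective
  \<open>f\<close> sends the orbit with \<open>x\<close> added into the orbit; if \<open>x\<close>
  were missing, a finite set would inject into a smaller one.\<close>

lemma bij_betw_self_in_orbit:
  assumes "finite \<Omega>" "bij_betw f \<Omega> \<Omega>" "x \<in> \<Omega>"
  shows "x \<in> orbit f x"
proof -
  have sub: "orbit f x \<subseteq> \<Omega>"
    using assms orbit_subset_closed by (metis bij_betw_imp_surj_on order_refl)
  have "f ` insert x (orbit f x) \<subseteq> orbit f x" by (auto intro: orbit.intros)
  moreover have "card (f ` insert x (orbit f x)) = card (insert x (orbit f x))"
  proof (rule card_image, rule inj_on_subset)
    show "inj_on f \<Omega>" using assms(2) by (simp add: bij_betw_def)
  qed (use assms(3) sub in blast)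
  moreover have "finite (orbit f x)" using sub assms(1) finite_subset by blast
  ultimately show ?thesis
    using card_mono[of "orbit f x" "f ` insert x (orbit f x)"] card_insert_disjoint[of "orbit f x" x]
    by fastforce
qed

text \<open>An injective self-map of the finite set \<open>A\<close> is onto, so the only preimage
  in \<open>\<Omega>\<close> of a point of \<open>A\<close> lies in \<open>A\<close>. Walking back
  along the orbit from \<open>y\<close> therefore stays in \<open>A\<close> until it reaches
  \<open>x\<close>.\<close>

lemma orbit_backward_closed:
  assumes "finite \<Omega>" "bij_betw f \<Omega> \<Omega>" "A \<subseteq> \<Omega>" "f ` A \<subseteq> A" "x \<in> \<Omega>"
    and "y \<in> orbit f x" "y \<in> A"
  shows "x \<in> A"
proof -
  have fA: "f ` A = A"
    using assms(1-4) by (metis bij_betw_def endo_inj_surj finite_subset inj_on_subset)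
  have pull: "z \<in> A" if "f z \<in> A" "z \<in> \<Omega>" for z
  proof -
    have "f z \<in> f ` A" using that(1) fA by simp
    then obtain a where "a \<in> A" "f a = f z" by force
    then show ?thesis using that(2) assms(2,3) by (metis bij_betw_def inj_onD subsetD)
  qed
  from assms(6,7) show ?thesis
  proof (induction)
    case base then show ?case using pull assms(5) by blast
  next
    case (step y)
    have "y \<in> \<Omega>" using orbit_subset_closed[of f \<Omega> x] assms(2,5) step(1) by (auto simp: bij_betw_def)
    then show ?case using step pull by blast
  qed
qed

text \<open>The orbit of \<open>y\<close> is closed under \<open>f\<close> and contains
  \<open>y\<close>, so backward closure puts \<open>x\<close> into it as well.\<close>

lemma bij_betw_orbit_eq:
  assumes "finite \<Omega>" "bij_betw f \<Omega> \<Omega>" "x \<in> \<Omega>" "y \<in> orbit f x"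
  shows "orbit f y = orbit f x"
proof -
  have sub: "orbit f x \<subseteq> \<Omega>"
    using assms orbit_subset_closed by (metis bij_betw_imp_surj_on order_refl)
  then have y: "y \<in> \<Omega>" using assms by blast
  have closed: "f ` orbit f z \<subseteq> orbit f z" for z by (auto intro: orbit.intros)
  have "orbit f y \<subseteq> orbit f x" using orbit_subset_closed[OF closed] assms(4) by blast
  moreover have "x \<in> orbit f y"
  proof (rule orbit_backward_closed[OF assms(1,2) _ closed assms(3,4)])
    show "orbit f y \<subseteq> \<Omega>" using calculation sub by blast
  qed (rule bij_betw_self_in_orbit[OF assms(1,2) y])
  then have "orbit f x \<subseteq> orbit f y" using orbit_subset_closed[OF closed] by blast
  ultimately show ?thesis by blast
qed

text \<open>The intertwining relation is demanded only on an invariant set \<open>A\<close>, because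
  isomorphisms and edge labellings are controlled only on the vertices of the map.\<close>

lemma orbit_semiconj:
  assumes "f ` A \<subseteq> A" "x \<in> A" "\<And>y. y \<in> A \<Longrightarrow> h (f y) = g (h y)"
  shows "h ` orbit f x = orbit g (h x)"
proof
  have sub: "orbit f x \<subseteq> A" using orbit_subset_closed assms(1,2) .
  show "h ` orbit f x \<subseteq> orbit g (h x)"
  proof
    fix z assume "z \<in> h ` orbit f x"
    then obtain y where "y \<in> orbit f x" "z = h y" by blast
    then show "z \<in> orbit g (h x)"
    proof (induction arbitrary: z)
      case base then show ?case using assms(2,3) by (auto intro: orbit.intros)
    next
      case (step y)
      then have "h (f y) = g (h y)" using sub assms(3) by blast
      then show ?case using step orbit.step by metis
    qed
  qed
  show "orbit g (h x) \<subseteq> h ` orbit f x"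
  proof
    fix z assume "z \<in> orbit g (h x)"
    then show "z \<in> h ` orbit f x"
    proof (induction)
      case base then show ?case using assms(2,3) by (metis image_eqI orbit.base)
    next
      case (step z)
      then obtain y where "y \<in> orbit f x" "z = h y" by blast
      then show ?case using sub assms(3) by (metis image_eqI orbit.step subsetD)
    qed
  qed
qed

section \<open>Closing up a partial bijection\<close>

text \<open>The new pairs lead from the end \<open>x\<close> of a maximal path back to its start
  \<open>y\<close>. A point of \<open>\<Omega>\<close> outside both domain and range is a path of
  length 0 and receives a loop.\<close>

definition cycle_closure :: "'a set \<Rightarrow> ('a \<times> 'a) set \<Rightarrow> ('a \<times> 'a) set" where
  "cycle_closure \<Omega> R = R \<union> {(x, y). x \<in> \<Omega> - Domain R \<and> y \<in> \<Omega> - Range R \<and> (y, x) \<in> R\<^sup>*}"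

lemma rtrancl_end_eq: "\<lbrakk>(x, y) \<in> R\<^sup>*; x \<notin> Domain R\<rbrakk> \<Longrightarrow> x = y"
  by (meson Not_Domain_rtrancl)

locale partial_bijection =
  fixes \<Omega> :: "'a set" and R :: "('a \<times> 'a) set"
  assumes finite_carrier: "finite \<Omega>"
    and subset_carrier: "R \<subseteq> \<Omega> \<times> \<Omega>"
    and sv: "single_valued R"
    and sv_conv: "single_valued (R\<inverse>)"
begin

lemma converse: "partial_bijection \<Omega> (R\<inverse>)"
  using finite_carrier subset_carrier sv sv_conv by unfold_locales auto

lemma rtrancl_carrier: "\<lbrakk>(x, y) \<in> R\<^sup>*; x \<in> \<Omega>\<rbrakk> \<Longrightarrow> y \<in> \<Omega>"
  by (induction rule: rtrancl_induct) (use subset_carrier in auto)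

text \<open>If no end were reachable, \<open>R\<close> would define an injective self-map of the
  finite set of points reachable from \<open>x\<close>. It would be onto, and \<open>x\<close> would
  have a predecessor.\<close>

lemma path_end:
  assumes "x \<in> \<Omega>" "x \<notin> Range R"
  shows "\<exists>y \<in> \<Omega> - Domain R. (x, y) \<in> R\<^sup>*"
proof (rule ccontr)
  assume neg: "\<not> ?thesis"
  define S where "S = R\<^sup>* `` {x}"
  have S: "S \<subseteq> \<Omega>" unfolding S_def using assms(1) rtrancl_carrier by blast
  have "\<forall>z\<in>S. \<exists>y. (z, y) \<in> R" using neg S unfolding S_def by blast
  then obtain f where f: "\<And>z. z \<in> S \<Longrightarrow> (z, f z) \<in> R" by metis
  have "inj_on f S" by (rule inj_onI) (metis f sv_conv converseI single_valuedD)
  moreover have "f ` S \<subseteq> S" unfolding S_def using f S_def by (auto intro: rtrancl_into_rtrancl)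
  ultimately have "f ` S = S" using S finite_carrier by (metis endo_inj_surj finite_subset)
  moreover have "x \<in> S" by (simp add: S_def)
  ultimately obtain z where "z \<in> S" "x = f z" by (metis (no_types) imageE)
  then show False using f assms(2) by (metis Range.intros)
qed

lemma path_start:
  assumes "x \<in> \<Omega>" "x \<notin> Domain R"
  shows "\<exists>y \<in> \<Omega> - Range R. (y, x) \<in> R\<^sup>*"
proof -
  interpret c: partial_bijection \<Omega> "R\<inverse>" by (rule converse)
  show ?thesis using c.path_end assms by (simp add: rtrancl_converse)
qed

lemma cycle_closure_carrier: "cycle_closure \<Omega> R \<subseteq> \<Omega> \<times> \<Omega>"
  unfolding cycle_closure_def using subset_carrier by auto

lemma cycle_closure_total: "x \<in> \<Omega> \<Longrightarrow> \<exists>y. (x, y) \<in> cycle_closure \<Omega> R"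
  unfolding cycle_closure_def using path_start by blast

text \<open>Two path starts leading to the same \<open>x\<close> are comparable along
  \<open>R\<close>, since predecessors are unique; a start has no predecessor, so they
  coincide.\<close>

lemma single_valued_cycle_closure: "single_valued (cycle_closure \<Omega> R)"
proof (rule single_valuedI)
  fix x y z assume xy: "(x, y) \<in> cycle_closure \<Omega> R" and xz: "(x, z) \<in> cycle_closure \<Omega> R"
  show "y = z"
  proof (cases "x \<in> Domain R")
    case True
    then show ?thesis using xy xz sv unfolding cycle_closure_def by (auto dest: single_valuedD)
  next
    case False
    then have "(y, x) \<in> R\<^sup>*" "(z, x) \<in> R\<^sup>*" and nr: "y \<notin> Range R" "z \<notin> Range R"
      using xy xz unfolding cycle_closure_def by auto
    then have "(x, y) \<in> (R\<inverse>)\<^sup>*" "(x, z) \<in> (R\<inverse>)\<^sup>*" by (simp_all add: rtrancl_converse)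
    then have "(y, z) \<in> (R\<inverse>)\<^sup>* \<or> (z, y) \<in> (R\<inverse>)\<^sup>*"
      using single_valued_confluent[OF sv_conv] by metis
    then show ?thesis using nr rtrancl_end_eq[of _ _ "R\<inverse>"] by (metis Domain_converse)
  qed
qed

text \<open>Reversing \<open>R\<close> exchanges starts and ends of paths. Injectivity of the
  closure is thereby reduced to single-valuedness for the reversed relation.\<close>

lemma cycle_closure_converse: "cycle_closure \<Omega> (R\<inverse>) = (cycle_closure \<Omega> R)\<inverse>"
  unfolding cycle_closure_def by (auto simp: rtrancl_converse)

lemma single_valued_cycle_closure_converse: "single_valued ((cycle_closure \<Omega> R)\<inverse>)"
proof -
  interpret c: partial_bijection \<Omega> "R\<inverse>" by (rule converse)
  show ?thesis using c.single_valued_cycle_closure by (simp add: cycle_closure_converse)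
qed

text \<open>Here \<open>s\<close> is any function whose values on \<open>\<Omega>\<close> are those
  of the closure; its values elsewhere are left open. It will stand both for the rotation read off a
  graph and for a permutation of a given stacked map.\<close>

context
  fixes s :: "'a \<Rightarrow> 'a"
  assumes s: "\<And>x. x \<in> \<Omega> \<Longrightarrow> (x, s x) \<in> cycle_closure \<Omega> R"
begin

lemma closure_fun_eq: "x \<in> \<Omega> \<Longrightarrow> (x, y) \<in> cycle_closure \<Omega> R \<longleftrightarrow> y = s x"
  using s single_valued_cycle_closure by (auto dest: single_valuedD)

lemma bij_closure_fun: "bij_betw s \<Omega> \<Omega>"
proof -
  have "inj_on s \<Omega>"
    by (rule inj_onI) (metis s single_valued_cycle_closure_converse converseI single_valuedD)
  moreover have "s ` \<Omega> \<subseteq> \<Omega>" using s cycle_closure_carrier by blast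
  ultimately show ?thesis using endo_inj_surj[OF finite_carrier] by (simp add: bij_betw_def)
qed

lemma rel_iff_closure_fun: "(x, y) \<in> R \<longleftrightarrow> x \<in> Domain R \<and> y = s x"
proof -
  have "(x, y) \<in> R \<longleftrightarrow> x \<in> Domain R \<and> (x, y) \<in> cycle_closure \<Omega> R"
    unfolding cycle_closure_def by auto
  then show ?thesis using closure_fun_eq subset_carrier by blast
qed

lemma closure_fun_rel: "x \<in> Domain R \<Longrightarrow> (x, s x) \<in> R"
  using rel_iff_closure_fun by blast

lemma closure_fun_path: "\<lbrakk>x \<in> \<Omega>; x \<notin> Domain R\<rbrakk> \<Longrightarrow> s x \<notin> Range R \<and> (s x, x) \<in> R\<^sup>*"
  using s[of x] unfolding cycle_closure_def by auto

text \<open>Starting from an end \<open>x\<close>, one application of \<open>s\<close> jumps to the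
  start of the path of \<open>x\<close>, and further ones run along that path back to
  \<open>x\<close>. So the orbit stays on one path, which has only one end.\<close>

lemma orbit_gap_unique:
  assumes "x \<in> \<Omega> - Domain R" "y \<in> \<Omega> - Domain R" "y \<in> orbit s x"
  shows "x = y"
proof -
  let ?P = "R\<^sup>* `` {s x}"
  have x: "x \<in> ?P" using closure_fun_path assms(1) by blast
  have only: "z = x" if "z \<in> ?P" "z \<notin> Domain R" for z
  proof -
    have "(x, z) \<in> R\<^sup>* \<or> (z, x) \<in> R\<^sup>*"
      using single_valued_confluent[OF sv] x that(1) by blast
    then show ?thesis using rtrancl_end_eq that(2) assms(1) by (metis DiffD2)
  qed
  have "s z \<in> ?P" if "z \<in> ?P" for z
  proof (cases "z \<in> Domain R")
    case True
    then show ?thesis using closure_fun_rel that by (auto intro: rtrancl_into_rtrancl)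
  next
    case False
    then show ?thesis using only that by blast
  qed
  then have "orbit s x \<subseteq> ?P" using x by (intro orbit_subset_closed) auto
  then show ?thesis using only assms(2,3) by blast
qed

text \<open>The left side describes unions of undirected components of \<open>R\<close>, the right
  side forward invariance under the completed permutation. Closing arcs connect nothing new, and
  finiteness turns forward into backward invariance. This is the bridge between the two kinds of
  connectedness.\<close>

lemma closed_iff_closure_fun_closed:
  assumes "A \<subseteq> \<Omega>"
  shows "(\<forall>(x, y)\<in>R. x \<in> A \<longleftrightarrow> y \<in> A) \<longleftrightarrow> s ` A \<subseteq> A"
proof
  assume cl: "\<forall>(x, y)\<in>R. x \<in> A \<longleftrightarrow> y \<in> A"
  have "s x \<in> A" if "x \<in> A" for x
  proof (cases "x \<in> Domain R")
    case True
    then show ?thesis using closure_fun_rel cl that by blast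
  next
    case False
    \<comment> \<open>The closing arc is replaced by the \<open>R\<close>-path between its ends,
      along which membership in \<open>A\<close> does not change.\<close>
    then have "(s x, x) \<in> R\<^sup>*" using closure_fun_path that assms by blast
    then show ?thesis by (induction rule: converse_rtrancl_induct) (use that cl in auto)
  qed
  then show "s ` A \<subseteq> A" by blast
next
  assume sA: "s ` A \<subseteq> A"
  show "\<forall>(x, y)\<in>R. x \<in> A \<longleftrightarrow> y \<in> A"
  proof clarify
    fix x y assume "(x, y) \<in> R"
    then have "y = s x" "x \<in> \<Omega>" using rel_iff_closure_fun subset_carrier by auto
    then show "x \<in> A \<longleftrightarrow> y \<in> A"
      using sA orbit_backward_closed[OF finite_carrier bij_closure_fun assms sA, of x y]
        orbit.base[of s x] by auto
  qed
qed

end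

end

section \<open>Connectedness by cuts\<close>

text \<open>A walk cannot leave a set that no arc crosses; conversely the set reachable from a
  vertex is such a set. The cut form avoids transporting walks between graphs and maps.\<close>

lemma connected_iff_no_cut:
  assumes "\<And>a. a \<in> arcs G \<Longrightarrow> tail G a \<in> verts G \<and> head G a \<in> verts G"
  shows "Digraph_Component.connected G \<longleftrightarrow> verts G \<noteq> {} \<and>
    (\<forall>S\<subseteq>verts G. S \<noteq> {} \<longrightarrow> (\<forall>a\<in>arcs G. tail G a \<in> S \<longleftrightarrow> head G a \<in> S) \<longrightarrow> S = verts G)"
    (is "?L \<longleftrightarrow> ?R")
proof
  let ?E = "parcs (mk_symmetric G)"
  have E: "(u, v) \<in> ?E \<longleftrightarrow> (\<exists>a\<in>arcs G. u = tail G a \<and> v = head G a \<or> u = head G a \<and> v = tail G a)" for u v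
    by (auto simp: parcs_mk_symmetric)
  have conn: "?L \<longleftrightarrow> verts G \<noteq> {} \<and>
      (\<forall>u\<in>verts G. \<forall>v\<in>verts G. (u, v) \<in> rtrancl_on (verts G) ?E)"
    by (simp add: connected_def strongly_connected_def reachable_def)
  show ?R if ?L
  proof (intro conjI allI impI)
    show "verts G \<noteq> {}" using that conn by blast
    fix S assume S: "S \<subseteq> verts G" "S \<noteq> {}" "\<forall>a\<in>arcs G. tail G a \<in> S \<longleftrightarrow> head G a \<in> S"
    obtain u where u: "u \<in> S" using S(2) by blast
    have "v \<in> S" if v: "v \<in> verts G" for v
    proof -
      have "(u, v) \<in> rtrancl_on (verts G) ?E" using conn \<open>?L\<close> u v S(1) by blast
      then show ?thesis by (induction rule: rtrancl_on_induct) (use u E S(3) in auto)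
    qed
    then show "S = verts G" using S(1) by blast
  qed
  show ?L if ?R
    unfolding conn
  proof (intro conjI ballI)
    show "verts G \<noteq> {}" using \<open>?R\<close> by blast
    fix u v assume u: "u \<in> verts G" and v: "v \<in> verts G"
    \<comment> \<open>Reachability in the symmetrised graph makes this set uncrossed by any
      arc.\<close>
    define S where "S = {v. (u, v) \<in> rtrancl_on (verts G) ?E}"
    have S: "S \<subseteq> verts G" "u \<in> S"
      using u unfolding S_def by (auto elim: rtrancl_on.cases)
    have "tail G a \<in> S \<longleftrightarrow> head G a \<in> S" if "a \<in> arcs G" for a
      using assms[OF that] E that unfolding S_def by (blast intro: rtrancl_on_into_rtrancl_on)
    then have "S = verts G" using \<open>?R\<close> S by blast
    then show "(u, v) \<in> rtrancl_on (verts G) ?E" using v S_def by blast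
  qed
qed

section \<open>Stacked maps as families of permutations\<close>

text \<open>
  Up to isomorphism a stacked map is a family of permutations \<open>\<sigma> c\<close> of its white vertices, together
  with the set \<open>K\<close> of white vertices whose corner at colour 0 is marked.
\<close>

definition map_data :: "nat \<Rightarrow> nat set \<Rightarrow> 'a set \<Rightarrow> (nat \<Rightarrow> 'a \<Rightarrow> 'a) \<Rightarrow> 'a set \<Rightarrow> bool" where
  "map_data q C \<Omega> \<sigma> K \<longleftrightarrow>
     finite \<Omega> \<and> \<Omega> \<noteq> {} \<and> (\<forall>c\<in>C. bij_betw (\<sigma> c) \<Omega> \<Omega>) \<and>
     K \<subseteq> \<Omega> \<and> (0 \<notin> C \<longrightarrow> K = {}) \<and> card K = q \<and>
     (\<forall>x\<in>K. \<forall>y\<in>K. y \<in> orbit (\<sigma> 0) x \<longrightarrow> x = y) \<and>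
     (\<forall>A\<subseteq>\<Omega>. A \<noteq> {} \<longrightarrow> (\<forall>c\<in>C. \<sigma> c ` A \<subseteq> A) \<longrightarrow> A = \<Omega>)"

text \<open>The record copies the shape of \<open>Psi_marked\<close>, with an arbitrary set in the
  role of the pairs. The image of a graph is then equal to a canonical map, not merely isomorphic to
  one.\<close>

definition canonical_map ::
    "nat set \<Rightarrow> 'a set \<Rightarrow> (nat \<Rightarrow> 'a \<Rightarrow> 'a) \<Rightarrow> 'a set \<Rightarrow> ('a, nat \<times> 'a set, nat \<times> 'a) smap" where
  "canonical_map C \<Omega> \<sigma> K =
     \<lparr>whites = \<Omega>, cverts = {(c, orbit (\<sigma> c) x) | c x. c \<in> C \<and> x \<in> \<Omega>}, medges = C \<times> \<Omega>,
      vcol = fst, ecol = fst, w_end = snd, c_end = (\<lambda>(c, x). (c, orbit (\<sigma> c) x)),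
      rot = (\<lambda>(c, x). (c, \<sigma> c x)), marked_corners = {((0, x), (0, \<sigma> 0 x)) | x. x \<in> K}\<rparr>"

definition data_isomorphic ::
    "nat set \<Rightarrow> 'a set \<Rightarrow> (nat \<Rightarrow> 'a \<Rightarrow> 'a) \<Rightarrow> 'a set \<Rightarrow>
     'b set \<Rightarrow> (nat \<Rightarrow> 'b \<Rightarrow> 'b) \<Rightarrow> 'b set \<Rightarrow> bool" where
  "data_isomorphic C \<Omega> \<sigma> K \<Omega>' \<sigma>' K' \<longleftrightarrow>
     (\<exists>f. bij_betw f \<Omega> \<Omega>' \<and> (\<forall>c\<in>C. \<forall>x\<in>\<Omega>. f (\<sigma> c x) = \<sigma>' c (f x)) \<and> f ` K = K')"

lemma map_data_orbit:
  assumes "map_data q C \<Omega> \<sigma> K" "c \<in> C" "x \<in> \<Omega>"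
  shows "orbit (\<sigma> c) x \<subseteq> \<Omega>" "x \<in> orbit (\<sigma> c) x" "\<sigma> c x \<in> \<Omega>"
    and "y \<in> orbit (\<sigma> c) x \<Longrightarrow> orbit (\<sigma> c) y = orbit (\<sigma> c) x"
proof -
  have fin: "finite \<Omega>" and bij: "bij_betw (\<sigma> c) \<Omega> \<Omega>" using assms by (auto simp: map_data_def)
  then have im: "\<sigma> c ` \<Omega> = \<Omega>" by (simp add: bij_betw_def)
  show "orbit (\<sigma> c) x \<subseteq> \<Omega>" using orbit_subset_closed[of "\<sigma> c" \<Omega> x] im assms(3) by simp
  show "x \<in> orbit (\<sigma> c) x" by (rule bij_betw_self_in_orbit[OF fin bij assms(3)])
  show "\<sigma> c x \<in> \<Omega>" using im assms(3) by blast
  show "orbit (\<sigma> c) y = orbit (\<sigma> c) x" if "y \<in> orbit (\<sigma> c) x"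
    by (rule bij_betw_orbit_eq[OF fin bij assms(3) that])
qed

text \<open>The edges at a coloured vertex are the copies \<open>Pair c\<close> of the points of one
  orbit, and \<open>rot\<close> moves them as \<open>\<sigma> c\<close> moves these points. At most
  one element of \<open>K\<close> per cycle of \<open>\<sigma> 0\<close> means at most one marked
  corner per vertex.\<close>

lemma canonical_map_stacked:
  assumes d: "map_data q C \<Omega> \<sigma> K" and C: "finite C"
  shows "stacked_map C (canonical_map C \<Omega> \<sigma> K)"
proof -
  let ?M = "canonical_map C \<Omega> \<sigma> K"
  note orb = map_data_orbit[OF d]
  have fin: "finite \<Omega>" and K: "K \<subseteq> \<Omega>" "K \<noteq> {} \<Longrightarrow> 0 \<in> C" using d by (auto simp: map_data_def)
  have cv: "cverts ?M = (\<lambda>(c, x). (c, orbit (\<sigma> c) x)) ` (C \<times> \<Omega>)"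
    by (auto simp: canonical_map_def)
  have cyc: "cyclic_on (rot ?M) {e \<in> medges ?M. c_end ?M e = v}" if "v \<in> cverts ?M" for v
  proof -
    from that obtain c x where v: "v = (c, orbit (\<sigma> c) x)" and cx: "c \<in> C" "x \<in> \<Omega>"
      unfolding cv by auto
    have fib: "{e \<in> medges ?M. c_end ?M e = v} = Pair c ` orbit (\<sigma> c) x"
    proof (intro set_eqI iffI)
      fix e assume "e \<in> {e \<in> medges ?M. c_end ?M e = v}"
      then obtain y where "e = (c, y)" "y \<in> \<Omega>" "orbit (\<sigma> c) y = orbit (\<sigma> c) x"
        by (auto simp: canonical_map_def v)
      then show "e \<in> Pair c ` orbit (\<sigma> c) x" using orb(2)[OF cx(1), of y] by auto
    next
      fix e assume "e \<in> Pair c ` orbit (\<sigma> c) x"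
      then obtain y where "e = (c, y)" "y \<in> orbit (\<sigma> c) x" by blast
      then show "e \<in> {e \<in> medges ?M. c_end ?M e = v}"
        using orb(1)[OF cx] orb(4)[OF cx] cx(1) by (auto simp: canonical_map_def v)
    qed
    have "Pair c ` orbit (\<sigma> c) x = orbit (rot ?M) (c, x)"
      by (rule orbit_semiconj[of _ UNIV]) (auto simp: canonical_map_def)
    then show ?thesis unfolding fib cyclic_on_def using orb(2)[OF cx] by (metis image_eqI)
  qed
  have inj: "inj_on (\<lambda>(e, e'). c_end ?M e) (marked_corners ?M)"
  proof (rule inj_onI)
    fix p p' assume p: "p \<in> marked_corners ?M" "p' \<in> marked_corners ?M"
      and eq: "(\<lambda>(e, e'). c_end ?M e) p = (\<lambda>(e, e'). c_end ?M e) p'"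
    from p obtain x x' where x: "x \<in> K" "p = ((0, x), (0, \<sigma> 0 x))"
      and x': "x' \<in> K" "p' = ((0, x'), (0, \<sigma> 0 x'))" by (auto simp: canonical_map_def)
    then have "orbit (\<sigma> 0) x = orbit (\<sigma> 0) x'" using eq by (simp add: canonical_map_def)
    moreover have "x' \<in> orbit (\<sigma> 0) x'" using orb(2) x'(1) K by blast
    ultimately have "x = x'" using d x(1) x'(1) by (simp add: map_data_def)
    then show "p = p'" using x x' by simp
  qed
  show ?thesis unfolding stacked_map_def
  proof (intro conjI)
    show "\<forall>v\<in>cverts ?M. cyclic_on (rot ?M) {e \<in> medges ?M. c_end ?M e = v}" using cyc by blast
    show "inj_on (\<lambda>(e, e'). c_end ?M e) (marked_corners ?M)" by (rule inj)
    show "finite (cverts ?M)" unfolding cv using C fin by simp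
    show "marked_corners ?M \<subseteq> {(e, rot ?M e) | e. e \<in> medges ?M \<and> vcol ?M (c_end ?M e) = 0}"
      using K by (auto simp: canonical_map_def)
    show "\<forall>w\<in>whites ?M. \<forall>c\<in>C. \<exists>!e. e \<in> medges ?M \<and> w_end ?M e = w \<and> ecol ?M e = c"
      by (auto simp: canonical_map_def)
  qed (use fin C in \<open>auto simp: canonical_map_def\<close>)
qed

text \<open>All white vertices on one orbit are adjacent to the same coloured vertex, so an
  uncrossed vertex set meets the white vertices in an invariant set. That trace is nonempty because
  every coloured vertex has a white neighbour.\<close>

lemma canonical_map_connected:
  assumes d: "map_data q C \<Omega> \<sigma> K"
  shows "smap_connected (canonical_map C \<Omega> \<sigma> K)"
proof -
  let ?M = "canonical_map C \<Omega> \<sigma> K"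
  let ?D = "\<lparr>verts = Inl ` whites ?M \<union> Inr ` cverts ?M, arcs = medges ?M,
      tail = Inl \<circ> w_end ?M, head = Inr \<circ> c_end ?M\<rparr>"
  note orb = map_data_orbit[OF d]
  have "Digraph_Component.connected ?D"
  proof (subst connected_iff_no_cut, goal_cases)
    case 1 then show ?case by (auto simp: canonical_map_def)
  next
    case 2
    have "S = verts ?D" if S: "S \<subseteq> verts ?D" "S \<noteq> {}"
      and cl: "\<forall>a\<in>arcs ?D. tail ?D a \<in> S \<longleftrightarrow> head ?D a \<in> S" for S
    proof -
      define A where "A = {x \<in> \<Omega>. Inl x \<in> S}"
      have e: "Inl x \<in> S \<longleftrightarrow> Inr (c, orbit (\<sigma> c) x) \<in> S" if "c \<in> C" "x \<in> \<Omega>" for c x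
        using cl that by (auto simp: canonical_map_def)
      have "A \<noteq> {}"
      proof -
        obtain s where "s \<in> S" using S(2) by blast
        then consider x where "s = Inl x" "x \<in> \<Omega>"
          | c x where "s = Inr (c, orbit (\<sigma> c) x)" "c \<in> C" "x \<in> \<Omega>"
          using S(1) by (auto simp: canonical_map_def)
        then show ?thesis using \<open>s \<in> S\<close> e unfolding A_def by cases auto
      qed
      moreover have "\<sigma> c ` A \<subseteq> A" if c: "c \<in> C" for c
      proof
        fix y assume "y \<in> \<sigma> c ` A"
        then obtain x where x: "x \<in> \<Omega>" "Inl x \<in> S" "y = \<sigma> c x" unfolding A_def by blast
        then have "y \<in> \<Omega>" "orbit (\<sigma> c) y = orbit (\<sigma> c) x"
          using orb(3)[OF c x(1)] orb(4)[OF c x(1), of y] orbit.base[of "\<sigma> c" x] by auto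
        then show "y \<in> A" unfolding A_def using e[OF c] x by auto
      qed
      moreover have "A \<subseteq> \<Omega>" unfolding A_def by blast
      ultimately have "A = \<Omega>" using d by (simp add: map_data_def)
      then have "Inl x \<in> S" if "x \<in> \<Omega>" for x using that unfolding A_def by blast
      then show ?thesis using S(1) e by (auto simp: canonical_map_def)
    qed
    then show ?case using d by (auto simp: canonical_map_def map_data_def)
  qed
  then show ?thesis unfolding smap_connected_def .
qed

lemma canonical_map_in_stacked_maps:
  assumes "map_data q C \<Omega> \<sigma> K" "finite C"
  shows "canonical_map C \<Omega> \<sigma> K \<in> stacked_maps q C"
proof -
  have "marked_corners (canonical_map C \<Omega> \<sigma> K) = (\<lambda>x. ((0, x), (0, \<sigma> 0 x))) ` K"
    by (auto simp: canonical_map_def)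
  moreover have "inj_on (\<lambda>x. ((0::nat, x), (0::nat, \<sigma> 0 x))) K" by (auto intro: inj_onI)
  ultimately have "card (marked_corners (canonical_map C \<Omega> \<sigma> K)) = q"
    using assms(1) by (simp add: card_image map_data_def)
  then show ?thesis
    using canonical_map_stacked[OF assms] canonical_map_connected[OF assms(1)]
    by (simp add: stacked_maps_def)
qed

text \<open>An edge is its colour together with its white end, so an isomorphism is governed by its
  action \<open>f\<close> on white vertices: it must send \<open>(c, x)\<close> to
  \<open>(c, f x)\<close>. Compatibility with \<open>rot\<close> then says that \<open>f\<close>
  conjugates the permutations.\<close>

lemma canonical_map_isomorphic_iff:
  assumes d: "map_data q C \<Omega> \<sigma> K" and d': "map_data q' C \<Omega>' \<sigma>' K'" and C: "C \<noteq> {}"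
  shows "smap_isomorphic (canonical_map C \<Omega> \<sigma> K) (canonical_map C \<Omega>' \<sigma>' K') \<longleftrightarrow>
    data_isomorphic C \<Omega> \<sigma> K \<Omega>' \<sigma>' K'"
    (is "smap_isomorphic ?M ?N \<longleftrightarrow> _")
proof
  have K: "K \<subseteq> \<Omega>" "K \<noteq> {} \<Longrightarrow> 0 \<in> C" and K': "K' \<subseteq> \<Omega>'" "K' \<noteq> {} \<Longrightarrow> 0 \<in> C"
    using d d' by (auto simp: map_data_def)
  {
    assume "smap_isomorphic ?M ?N"
    then obtain f g h where f: "bij_betw f \<Omega> \<Omega>'" and h: "bij_betw h (C \<times> \<Omega>) (C \<times> \<Omega>')"
      and e: "\<And>e. e \<in> C \<times> \<Omega> \<Longrightarrow> snd (h e) = f (snd e) \<and> fst (h e) = fst e \<and>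
         rot ?N (h e) = h (rot ?M e)"
      and m: "map_prod h h ` marked_corners ?M = marked_corners ?N"
      unfolding smap_isomorphic_def by (auto simp: canonical_map_def)
    have h_eq: "h (c, x) = (c, f x)" if "c \<in> C" "x \<in> \<Omega>" for c x
      using e[of "(c, x)"] that by (simp add: prod_eq_iff)
    have comm: "f (\<sigma> c x) = \<sigma>' c (f x)" if "c \<in> C" "x \<in> \<Omega>" for c x
      using e[of "(c, x)"] that map_data_orbit(3)[OF d that] by (simp add: h_eq canonical_map_def)
    \<comment> \<open>The marks are read back as the white ends of the first edges of the marked
      corners.\<close>
    have "K = (snd \<circ> fst) ` marked_corners ?M" "K' = (snd \<circ> fst) ` marked_corners ?N"
      by (force simp: canonical_map_def)+
    moreover have "(snd \<circ> fst) ` map_prod h h ` marked_corners ?M = f ` (snd \<circ> fst) ` marked_corners ?M"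
    proof -
      have "(snd \<circ> fst) (map_prod h h p) = f ((snd \<circ> fst) p)" if p: "p \<in> marked_corners ?M" for p
      proof -
        from p obtain x where x: "x \<in> K" "p = ((0, x), (0, \<sigma> 0 x))" by (auto simp: canonical_map_def)
        then have "0 \<in> C" "x \<in> \<Omega>" using K by blast+
        then show ?thesis using h_eq x by simp
      qed
      then show ?thesis by (simp add: image_image)
    qed
    ultimately have "f ` K = K'" using m by simp
    then show "data_isomorphic C \<Omega> \<sigma> K \<Omega>' \<sigma>' K'"
      unfolding data_isomorphic_def using f comm by blast
  next
    assume "data_isomorphic C \<Omega> \<sigma> K \<Omega>' \<sigma>' K'"
    then obtain f where f: "bij_betw f \<Omega> \<Omega>'"
      and comm: "\<And>c x. c \<in> C \<Longrightarrow> x \<in> \<Omega> \<Longrightarrow> f (\<sigma> c x) = \<sigma>' c (f x)" and fK: "f ` K = K'"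
      unfolding data_isomorphic_def by blast
    have im: "f ` \<Omega> = \<Omega>'" and inj: "inj_on f \<Omega>" using f by (auto simp: bij_betw_def)
    have orb: "f ` orbit (\<sigma> c) x = orbit (\<sigma>' c) (f x)" if "c \<in> C" "x \<in> \<Omega>" for c x
      by (rule orbit_semiconj[of _ \<Omega>]) (use that comm map_data_orbit(3)[OF d] in auto)
    let ?g = "map_prod id ((`) f)" and ?h = "map_prod id f"
    have cv: "cverts ?M = (\<lambda>(c, x). (c, orbit (\<sigma> c) x)) ` (C \<times> \<Omega>)"
      "cverts ?N = (\<lambda>(c, x). (c, orbit (\<sigma>' c) x)) ` (C \<times> \<Omega>')"
      by (auto simp: canonical_map_def)
    show "smap_isomorphic ?M ?N" unfolding smap_isomorphic_def
    proof (intro exI[of _ f] exI[of _ ?g] exI[of _ ?h] conjI)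
      show "bij_betw f (whites ?M) (whites ?N)" using f by (simp add: canonical_map_def)
      show "bij_betw ?g (cverts ?M) (cverts ?N)" unfolding bij_betw_def
      proof
        show "inj_on ?g (cverts ?M)"
        proof (rule inj_onI)
          fix u v assume uv: "u \<in> cverts ?M" "v \<in> cverts ?M" "?g u = ?g v"
          \<comment> \<open>Taking images under \<open>f\<close> is injective only on subsets of
            \<open>\<Omega>\<close>, hence the need to locate the orbits there.\<close>
          then have "snd u \<subseteq> \<Omega>" "snd v \<subseteq> \<Omega>"
            unfolding cv(1) using map_data_orbit(1)[OF d] by fastforce+
          then have "snd u = snd v" using uv(3) inj_on_image_eq_iff[OF inj] by (cases u; cases v) auto
          then show "u = v" using uv(3) by (cases u; cases v) auto
        qed
        have "?g ` cverts ?M = (\<lambda>(c, x). (c, orbit (\<sigma>' c) x)) ` ?h ` (C \<times> \<Omega>)"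
          unfolding cv(1) image_image using orb by (intro image_cong) auto
        also have "?h ` (C \<times> \<Omega>) = C \<times> \<Omega>'" using im by (simp add: map_prod_surj_on)
        finally show "?g ` cverts ?M = cverts ?N" unfolding cv(2) .
      qed
      show "bij_betw ?h (medges ?M) (medges ?N)"
        using f by (simp add: canonical_map_def bij_betw_map_prod)
      show "\<forall>v\<in>cverts ?M. vcol ?N (?g v) = vcol ?M v" by (simp add: canonical_map_def)
      show "\<forall>e\<in>medges ?M. w_end ?N (?h e) = f (w_end ?M e) \<and> c_end ?N (?h e) = ?g (c_end ?M e) \<and>
        ecol ?N (?h e) = ecol ?M e \<and> rot ?N (?h e) = ?h (rot ?M e)"
        using orb comm by (auto simp: canonical_map_def)
      have "?h (0, \<sigma> 0 x) = (0, \<sigma>' 0 (f x))" if "x \<in> K" for x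
        using that K comm by auto
      then show "map_prod ?h ?h ` marked_corners ?M = marked_corners ?N"
        unfolding fK[symmetric] canonical_map_def by (fastforce simp: image_iff)
    qed
  }
qed

section \<open>Normal form of a stacked map\<close>

text \<open>A coloured vertex can be replaced by its colour and the set of its white neighbours:
  this set is a cycle of a permutation of the white vertices, and it determines the vertex because a
  white vertex has only one edge of each colour.\<close>

lemma stacked_map_canonical:
  assumes M: "M \<in> stacked_maps q C"
  shows "\<exists>\<sigma> K. map_data q C (whites M) \<sigma> K \<and> smap_isomorphic M (canonical_map C (whites M) \<sigma> K)"
proof -
  have st: "stacked_map C M" and conn: "smap_connected M" and card: "card (marked_corners M) = q"
    using M by (auto simp: stacked_maps_def)
  have fin: "finite (whites M)" "finite (medges M)"
    and ends: "\<And>e. e \<in> medges M \<Longrightarrow>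
      w_end M e \<in> whites M \<and> c_end M e \<in> cverts M \<and> vcol M (c_end M e) = ecol M e"
    and vcol: "\<And>v. v \<in> cverts M \<Longrightarrow> vcol M v \<in> C"
    and ex1: "\<And>w c. w \<in> whites M \<Longrightarrow> c \<in> C \<Longrightarrow> \<exists>!e. e \<in> medges M \<and> w_end M e = w \<and> ecol M e = c"
    and cyc: "\<And>v. v \<in> cverts M \<Longrightarrow> cyclic_on (rot M) {e \<in> medges M. c_end M e = v}"
    and mc: "marked_corners M \<subseteq> {(e, rot M e) | e. e \<in> medges M \<and> vcol M (c_end M e) = 0}"
    and mcinj: "inj_on (\<lambda>(e, e'). c_end M e) (marked_corners M)"
    using st unfolding stacked_map_def by blast+
  have ecol: "ecol M e \<in> C" if "e \<in> medges M" for e using ends vcol that by metis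
  \<comment> \<open>Edges are addressed by colour and white end; \<open>ed_eq\<close> shows that the
    address determines the edge.\<close>
  define ed where "ed c w = (THE e. e \<in> medges M \<and> w_end M e = w \<and> ecol M e = c)" for c w
  have ed: "ed c w \<in> medges M \<and> w_end M (ed c w) = w \<and> ecol M (ed c w) = c"
    if "w \<in> whites M" "c \<in> C" for w c
    unfolding ed_def using theI'[OF ex1[OF that]] .
  have ed_eq: "ed (ecol M e) (w_end M e) = e" if "e \<in> medges M" for e
    using ex1[of "w_end M e" "ecol M e"] ed[of "w_end M e" "ecol M e"] ends[OF that] ecol[OF that] that by blast
  have rot_in: "rot M e \<in> medges M" if "e \<in> medges M" for e
    using stacked_map_rot[OF st that] .
  have fibre: "orbit (rot M) e = {e' \<in> medges M. c_end M e' = c_end M e}" if "e \<in> medges M" for e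
  proof -
    have "e \<in> {e' \<in> medges M. c_end M e' = c_end M e}" using that by simp
    then show ?thesis using cyc[of "c_end M e"] ends that orbit_cyclic_eq3 by metis
  qed
  have rot_c: "c_end M (rot M e) = c_end M e" if "e \<in> medges M" for e
    using fibre[OF that] orbit.base[of "rot M" e] by blast
  have rot_col: "ecol M (rot M e) = ecol M e" if "e \<in> medges M" for e
    using ends rot_c rot_in that by metis
  have rot_surj: "e \<in> rot M ` medges M" if "e \<in> medges M" for e
  proof -
    have "e \<in> orbit (rot M) e" using fibre that by blast
    then show ?thesis
    proof (cases rule: orbit.cases)
      case base then show ?thesis using that by blast
    next
      case (step y) then show ?thesis using fibre that by blast
    qed
  qed
  \<comment> \<open>Go out along the edge of colour \<open>c\<close>, turn to the next edge around
    the coloured vertex, and come back to a white vertex.\<close>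
  define \<sigma> where "\<sigma> c w = w_end M (rot M (ed c w))" for c w
  define K where "K = (\<lambda>p. w_end M (fst p)) ` marked_corners M"
  have ed_\<sigma>: "ed c (\<sigma> c w) = rot M (ed c w)" if "c \<in> C" "w \<in> whites M" for c w
    using ed_eq[of "rot M (ed c w)"] rot_in rot_col ed that unfolding \<sigma>_def by metis
  have \<sigma>_in: "\<sigma> c w \<in> whites M" if "c \<in> C" "w \<in> whites M" for c w
    unfolding \<sigma>_def using ends rot_in ed that by blast
  have bij: "bij_betw (\<sigma> c) (whites M) (whites M)" if c: "c \<in> C" for c
  proof -
    have "whites M \<subseteq> \<sigma> c ` whites M"
    proof
      fix w assume w: "w \<in> whites M"
      then obtain e where e: "e \<in> medges M" "rot M e = ed c w" using rot_surj ed c by (metis imageE)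
      then have "ed c (w_end M e) = e" using ed_eq rot_col ed c w by metis
      then have "\<sigma> c (w_end M e) = w" unfolding \<sigma>_def using e ed c w by simp
      then show "w \<in> \<sigma> c ` whites M" using ends e(1) by blast
    qed
    then have "\<sigma> c ` whites M = whites M" using \<sigma>_in c by blast
    then show ?thesis using finite_surj_inj[OF fin(1), of "\<sigma> c"] by (simp add: bij_betw_def)
  qed
  have orb: "orbit (\<sigma> c) w = w_end M ` {e \<in> medges M. c_end M e = c_end M (ed c w)}"
    if "c \<in> C" "w \<in> whites M" for c w
  proof -
    have "ed c ` orbit (\<sigma> c) w = orbit (rot M) (ed c w)"
      by (rule orbit_semiconj[of _ "whites M"]) (use \<sigma>_in ed_\<sigma> that in auto)
    moreover have "w_end M ` ed c ` orbit (\<sigma> c) w = orbit (\<sigma> c) w"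
    proof -
      have "orbit (\<sigma> c) w \<subseteq> whites M"
        using orbit_subset_closed[of "\<sigma> c" "whites M" w] \<sigma>_in that by blast
      then show ?thesis unfolding image_image using ed that(1) by (force simp: image_iff)
    qed
    ultimately show ?thesis using fibre ed that by simp
  qed
  have mark: "\<exists>e. p = (e, rot M e) \<and> e \<in> medges M \<and> e = ed 0 (w_end M e) \<and> 0 \<in> C"
    if "p \<in> marked_corners M" for p
  proof -
    from that mc obtain e where e: "p = (e, rot M e)" "e \<in> medges M" "vcol M (c_end M e) = 0" by blast
    then have "ecol M e = 0" using ends by simp
    then show ?thesis using e ed_eq ecol by metis
  qed
  have markK: "\<exists>e. (e, rot M e) \<in> marked_corners M \<and> x = w_end M e \<and> e \<in> medges M \<and> e = ed 0 x \<and> 0 \<in> C"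
    if x: "x \<in> K" for x
  proof -
    from x obtain p where p: "p \<in> marked_corners M" "x = w_end M (fst p)" unfolding K_def by blast
    from mark[OF p(1)] obtain e where "p = (e, rot M e)" "e \<in> medges M" "e = ed 0 (w_end M e)" "0 \<in> C"
      by blast
    then show ?thesis using p by (intro exI[of _ e]) simp
  qed
  have cpl: "A = whites M" if A: "A \<subseteq> whites M" "A \<noteq> {}" "\<forall>c\<in>C. \<sigma> c ` A \<subseteq> A" for A
  proof -
    let ?D = "\<lparr>verts = Inl ` whites M \<union> Inr ` cverts M, arcs = medges M,
      tail = Inl \<circ> w_end M, head = Inr \<circ> c_end M\<rparr>"
    \<comment> \<open>The candidate for an uncrossed set consists of \<open>A\<close> and all
      coloured neighbours of \<open>A\<close>.\<close>
    let ?S = "Inl ` A \<union> Inr ` c_end M ` {e \<in> medges M. w_end M e \<in> A}"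
    \<comment> \<open>This is the nontrivial direction for the cut. The white neighbours of one
      coloured vertex form a single orbit, so an invariant set containing one of them contains
      all.\<close>
    have back_A: "w_end M e \<in> A" if e: "e \<in> medges M" "e' \<in> medges M" "c_end M e = c_end M e'" "w_end M e' \<in> A"
      for e e'
    proof -
      let ?c = "ecol M e"
      have c: "ecol M e' = ?c" using ends e by metis
      have "w_end M e \<in> orbit (\<sigma> ?c) (w_end M e')"
        using orb[of ?c "w_end M e'"] ed_eq[OF e(2)] ecol[OF e(1)] ends[OF e(2)] e c by auto
      moreover have "orbit (\<sigma> ?c) (w_end M e') \<subseteq> A"
        using orbit_subset_closed A(3) ecol[OF e(1)] e(4) by metis
      ultimately show ?thesis by blast
    qed
    have "?S = verts ?D"
    proof -
      have D: "arcs ?D = medges M" "tail ?D = Inl \<circ> w_end M" "head ?D = Inr \<circ> c_end M" by simp_all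
      have 1: "?S \<subseteq> verts ?D" using A(1) ends by auto
      have 2: "?S \<noteq> {}" using A(2) by blast
      have 3: "\<forall>a\<in>arcs ?D. tail ?D a \<in> ?S \<longleftrightarrow> head ?D a \<in> ?S"
        unfolding D using back_A by (auto simp: image_iff)
      have "\<forall>S\<subseteq>verts ?D. S \<noteq> {} \<longrightarrow> (\<forall>a\<in>arcs ?D. tail ?D a \<in> S \<longleftrightarrow> head ?D a \<in> S) \<longrightarrow> S = verts ?D"
        using conn connected_iff_no_cut[of ?D] ends unfolding smap_connected_def by simp
      from this[rule_format, OF 1 2 3[rule_format]] show ?thesis .
    qed
    then show ?thesis using A(1) by auto
  qed
  have ne: "whites M \<noteq> {}"
  proof -
    have "whites M \<noteq> {} \<or> cverts M \<noteq> {}"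
      using conn unfolding smap_connected_def connected_def strongly_connected_def by auto
    moreover have "whites M \<noteq> {}" if "v \<in> cverts M" for v
    proof -
      have "{e \<in> medges M. c_end M e = v} \<noteq> {}" using cyc[OF that] by (auto simp: cyclic_on_def)
      then show ?thesis using ends by blast
    qed
    ultimately show ?thesis by blast
  qed
  have d: "map_data q C (whites M) \<sigma> K" unfolding map_data_def
  proof (intro conjI ballI impI allI)
    show "K \<subseteq> whites M" using markK ends by blast
    show "K = {}" if "0 \<notin> C" using that markK by blast
    show "x = y" if x: "x \<in> K" and y: "y \<in> K" and o: "y \<in> orbit (\<sigma> 0) x" for x y
    proof -
      from markK[OF x] obtain e where e: "(e, rot M e) \<in> marked_corners M" "x = w_end M e"
        "e \<in> medges M" "e = ed 0 x" "0 \<in> C" by blast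
      from markK[OF y] obtain e' where e': "(e', rot M e') \<in> marked_corners M" "y = w_end M e'"
        "e' \<in> medges M" "e' = ed 0 y" by blast
      have xw: "x \<in> whites M" unfolding e(2) using ends e(3) by blast
      have "orbit (\<sigma> 0) x = w_end M ` {e'' \<in> medges M. c_end M e'' = c_end M e}"
        using orb[OF e(5) xw] unfolding e(4)[symmetric] .
      \<comment> \<open>The orbit of \<open>x\<close> consists of the white ends at the coloured
        vertex of \<open>e\<close>. The edge found there has colour 0 and white end
        \<open>y\<close>, hence it is \<open>e'\<close>; so \<open>e\<close> and \<open>e'\<close>
        begin marked corners at one vertex.\<close>
      then have "y \<in> w_end M ` {e'' \<in> medges M. c_end M e'' = c_end M e}" using o by simp
      then obtain e'' where e'': "e'' \<in> medges M" "c_end M e'' = c_end M e" "w_end M e'' = y" by blast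
      have "ecol M e = 0" using ed[OF xw e(5)] unfolding e(4)[symmetric] by blast
      then have "ecol M e'' = 0" using ends[OF e''(1)] ends[OF e(3)] e''(2) by simp
      then have "e'' = e'" using ed_eq[OF e''(1)] e''(3) e'(4) by metis
      then have "c_end M e = c_end M e'" using e''(2) by simp
      then have "(e, rot M e) = (e', rot M e')"
        using inj_onD[OF mcinj _ e(1) e'(1)] by simp
      then show ?thesis using e(2) e'(2) by simp
    qed
    show "card K = q"
    proof -
      have "inj_on (\<lambda>p. w_end M (fst p)) (marked_corners M)"
      proof (rule inj_onI)
        fix p p' assume p: "p \<in> marked_corners M" "p' \<in> marked_corners M" "w_end M (fst p) = w_end M (fst p')"
        from mark[OF p(1)] obtain e where e: "p = (e, rot M e)" "e = ed 0 (w_end M e)" by blast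
        from mark[OF p(2)] obtain e' where e': "p' = (e', rot M e')" "e' = ed 0 (w_end M e')" by blast
        have "w_end M e = w_end M e'" using p(3) e(1) e'(1) by simp
        then have "e = e'" using e(2) e'(2) by metis
        then show "p = p'" using e(1) e'(1) by simp
      qed
      then show ?thesis unfolding K_def using card by (simp add: card_image)
    qed
  qed (use fin ne bij cpl in auto)
  let ?N = "canonical_map C (whites M) \<sigma> K"
  let ?h = "\<lambda>e. (ecol M e, w_end M e)"
  \<comment> \<open>This is the vertex name used by \<open>canonical_map\<close>: the set of white
    neighbours is the orbit, as stated in \<open>orb\<close>.\<close>
  let ?g = "\<lambda>v. (vcol M v, w_end M ` {e \<in> medges M. c_end M e = v})"
  have g: "?g (c_end M e) = (ecol M e, orbit (\<sigma> (ecol M e)) (w_end M e))" if "e \<in> medges M" for e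
    using orb[of "ecol M e" "w_end M e"] ed_eq ends ecol that by simp
  have surj_c: "\<exists>e\<in>medges M. c_end M e = v" if "v \<in> cverts M" for v
    using cyc[OF that] by (auto simp: cyclic_on_def)
  have surj_h: "?h ` medges M = C \<times> whites M"
  proof
    show "C \<times> whites M \<subseteq> ?h ` medges M"
    proof clarify
      fix c w assume "c \<in> C" "w \<in> whites M"
      then show "(c, w) \<in> ?h ` medges M" using ed[of w c] by (intro image_eqI[of _ _ "ed c w"]) auto
    qed
  qed (use ends ecol in auto)
  have "smap_isomorphic M ?N" unfolding smap_isomorphic_def
  proof (intro exI[of _ id] exI[of _ ?g] exI[of _ ?h] conjI)
    show "bij_betw id (whites M) (whites ?N)" by (simp add: canonical_map_def)
    show "bij_betw ?g (cverts M) (cverts ?N)" unfolding bij_betw_def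
    proof
      show "inj_on ?g (cverts M)"
      proof (rule inj_onI)
        fix u v assume uv: "u \<in> cverts M" "v \<in> cverts M" "?g u = ?g v"
        obtain e where e: "e \<in> medges M" "c_end M e = u" using surj_c uv(1) by blast
        then have "w_end M e \<in> w_end M ` {e \<in> medges M. c_end M e = v}" using uv(3) by auto
        then obtain e' where e': "e' \<in> medges M" "c_end M e' = v" "w_end M e' = w_end M e" by auto
        have "ecol M e = ecol M e'" using uv(3) ends e e' by auto
        then have "e = e'" using ed_eq e(1) e'(1,3) by metis
        then show "u = v" using e e' by simp
      qed
      have "cverts M = c_end M ` medges M" using surj_c ends by blast
      then have "?g ` cverts M = (\<lambda>(c, x). (c, orbit (\<sigma> c) x)) ` ?h ` medges M"
        unfolding image_image using g by (simp add: image_image cong: image_cong)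
      then show "?g ` cverts M = cverts ?N" unfolding surj_h by (auto simp: canonical_map_def)
    qed
    show "bij_betw ?h (medges M) (medges ?N)" unfolding bij_betw_def
      using surj_h by (auto simp: canonical_map_def intro!: inj_onI) (metis ed_eq)
    show "\<forall>v\<in>cverts M. vcol ?N (?g v) = vcol M v" by (simp add: canonical_map_def)
    show "\<forall>e\<in>medges M. w_end ?N (?h e) = id (w_end M e) \<and> c_end ?N (?h e) = ?g (c_end M e) \<and>
        ecol ?N (?h e) = ecol M e \<and> rot ?N (?h e) = ?h (rot M e)"
    proof
      fix e assume e: "e \<in> medges M"
      have "\<sigma> (ecol M e) (w_end M e) = w_end M (rot M e)" unfolding \<sigma>_def using ed_eq e by simp
      then show "w_end ?N (?h e) = id (w_end M e) \<and> c_end ?N (?h e) = ?g (c_end M e) \<and>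
        ecol ?N (?h e) = ecol M e \<and> rot ?N (?h e) = ?h (rot M e)"
        using g e rot_col by (simp add: canonical_map_def)
    qed
    show "map_prod ?h ?h ` marked_corners M = marked_corners ?N"
    proof -
      have "map_prod ?h ?h p = ((0, w_end M (fst p)), (0, \<sigma> 0 (w_end M (fst p))))"
        if p: "p \<in> marked_corners M" for p
      proof -
        from mark[OF p] obtain e where e: "p = (e, rot M e)" "e \<in> medges M" "e = ed 0 (w_end M e)" "0 \<in> C"
          by blast
        have "w_end M e \<in> whites M" using ends e(2) by blast
        then have "ecol M e = 0" using ed[of "w_end M e" 0] e(4) unfolding e(3)[symmetric] by blast
        then show ?thesis using e(1,2) rot_col[OF e(2)] unfolding \<sigma>_def by (simp add: e(3)[symmetric])
      qed
      then show ?thesis unfolding K_def by (auto simp: canonical_map_def image_iff)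
    qed
  qed
  then show ?thesis using d by blast
qed

section \<open>Erasing the marks\<close>

text \<open>The part of \<open>\<sigma> c\<close> that does not come from marked corners.\<close>

definition data_step :: "'a set \<Rightarrow> (nat \<Rightarrow> 'a \<Rightarrow> 'a) \<Rightarrow> 'a set \<Rightarrow> nat \<Rightarrow> ('a \<times> 'a) set" where
  "data_step \<Omega> \<sigma> K c = {(x, \<sigma> c x) | x. x \<in> \<Omega> \<and> \<not> (c = 0 \<and> x \<in> K)}"

lemma Domain_data_step: "Domain (data_step \<Omega> \<sigma> K c) = {x \<in> \<Omega>. \<not> (c = 0 \<and> x \<in> K)}"
  by (auto simp: data_step_def)

lemma partial_bijection_data_step:
  assumes "map_data q C \<Omega> \<sigma> K" "c \<in> C"
  shows "partial_bijection \<Omega> (data_step \<Omega> \<sigma> K c)"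
proof
  have "bij_betw (\<sigma> c) \<Omega> \<Omega>" and fin: "finite \<Omega>" using assms by (auto simp: map_data_def)
  then have im: "\<sigma> c ` \<Omega> = \<Omega>" and inj: "inj_on (\<sigma> c) \<Omega>" by (auto simp: bij_betw_def)
  show "finite \<Omega>" by (rule fin)
  show "data_step \<Omega> \<sigma> K c \<subseteq> \<Omega> \<times> \<Omega>" using im by (auto simp: data_step_def)
  show "single_valued (data_step \<Omega> \<sigma> K c)" by (auto simp: data_step_def single_valued_def)
  show "single_valued ((data_step \<Omega> \<sigma> K c)\<inverse>)"
    using inj by (auto simp: data_step_def single_valued_def dest: inj_onD)
qed

text \<open>
  A cycle of \<open>\<sigma> 0\<close> has at most one marked element, so the marked corners are the ones that close up
  the remaining paths.
\<close>

lemma map_data_closure: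
  assumes d: "map_data q C \<Omega> \<sigma> K" and c: "c \<in> C" and x: "x \<in> \<Omega>"
  shows "(x, \<sigma> c x) \<in> cycle_closure \<Omega> (data_step \<Omega> \<sigma> K c)"
proof (cases "c = 0 \<and> x \<in> K")
  case False
  then show ?thesis using x by (auto simp: cycle_closure_def data_step_def)
next
  case True
  let ?R = "data_step \<Omega> \<sigma> K c"
  interpret partial_bijection \<Omega> ?R using d c by (rule partial_bijection_data_step)
  have inj: "inj_on (\<sigma> c) \<Omega>" using d c by (auto simp: map_data_def bij_betw_def)
  have sx: "\<sigma> c x \<in> \<Omega>" using map_data_orbit(3)[OF d c x] .
  have nr: "\<sigma> c x \<notin> Range ?R"
  proof
    assume "\<sigma> c x \<in> Range ?R"
    then obtain z where "z \<in> \<Omega>" "\<sigma> c z = \<sigma> c x" "\<not> (c = 0 \<and> z \<in> K)" by (auto simp: data_step_def)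
    then show False using inj x True by (metis inj_onD)
  qed
  \<comment> \<open>The unmarked path beginning at \<open>\<sigma> c x\<close> has to stop. It can
    stop only at a marked element, and on this cycle the only one is \<open>x\<close>.\<close>
  obtain y where y: "y \<in> \<Omega> - Domain ?R" "(\<sigma> c x, y) \<in> ?R\<^sup>*" using path_end[OF sx nr] by blast
  from y(2) have "y \<in> orbit (\<sigma> c) x"
    by (induction rule: rtrancl_induct) (auto simp: data_step_def intro: orbit.intros)
  moreover have "y \<in> K" using y(1) by (auto simp: Domain_data_step)
  ultimately have "x = y" using d True by (simp add: map_data_def)
  then show ?thesis using x sx nr y(1) y(2) by (auto simp: cycle_closure_def)
qed

text \<open>Nothing is lost by forgetting marks: the closure restores the permutations, and the
  marked elements are the points where the colour 0 step is undefined. So a bijection respecting the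
  unmarked steps respects the whole data.\<close>

lemma data_isomorphic_iff_step:
  assumes d: "map_data q C \<Omega> \<sigma> K" and d': "map_data q' C \<Omega>' \<sigma>' K'"
  shows "data_isomorphic C \<Omega> \<sigma> K \<Omega>' \<sigma>' K' \<longleftrightarrow>
    (\<exists>f. bij_betw f \<Omega> \<Omega>' \<and> (\<forall>c\<in>C. map_prod f f ` data_step \<Omega> \<sigma> K c = data_step \<Omega>' \<sigma>' K' c))"
    (is "?L \<longleftrightarrow> ?R")
proof
  have K: "K \<subseteq> \<Omega>" "K' \<subseteq> \<Omega>'" "0 \<notin> C \<Longrightarrow> K = {} \<and> K' = {}" using d d' by (auto simp: map_data_def)
  show ?R if ?L
  proof -
    from that obtain f where f: "bij_betw f \<Omega> \<Omega>'"
      and comm: "\<And>c x. c \<in> C \<Longrightarrow> x \<in> \<Omega> \<Longrightarrow> f (\<sigma> c x) = \<sigma>' c (f x)" and fK: "f ` K = K'"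
      unfolding data_isomorphic_def by blast
    have im: "f ` \<Omega> = \<Omega>'" and inj: "inj_on f \<Omega>" using f by (auto simp: bij_betw_def)
    have mem: "f x \<in> K' \<longleftrightarrow> x \<in> K" if "x \<in> \<Omega>" for x
      unfolding fK[symmetric] using inj_on_image_mem_iff[OF inj that K(1)] .
    have "map_prod f f ` data_step \<Omega> \<sigma> K c = data_step \<Omega>' \<sigma>' K' c" if c: "c \<in> C" for c
    proof -
      have "map_prod f f ` data_step \<Omega> \<sigma> K c =
          (\<lambda>x. (f x, \<sigma>' c (f x))) ` {x \<in> \<Omega>. \<not> (c = 0 \<and> x \<in> K)}"
        using comm[OF c] by (force simp: data_step_def)
      also have "\<dots> = (\<lambda>x. (x, \<sigma>' c x)) ` f ` {x \<in> \<Omega>. \<not> (c = 0 \<and> x \<in> K)}" by (simp add: image_image)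
      also have "f ` {x \<in> \<Omega>. \<not> (c = 0 \<and> x \<in> K)} = {x \<in> \<Omega>'. \<not> (c = 0 \<and> x \<in> K')}"
        unfolding im[symmetric] using mem by auto
      finally show ?thesis by (auto simp: data_step_def)
    qed
    then show ?thesis using f by blast
  qed
  show ?L if ?R
  proof -
    from that obtain f where f: "bij_betw f \<Omega> \<Omega>'"
      and step: "\<And>c. c \<in> C \<Longrightarrow> map_prod f f ` data_step \<Omega> \<sigma> K c = data_step \<Omega>' \<sigma>' K' c" by blast
    have im: "f ` \<Omega> = \<Omega>'" and inj: "inj_on f \<Omega>" using f by (auto simp: bij_betw_def)
    have dom: "f ` Domain (data_step \<Omega> \<sigma> K c) = Domain (data_step \<Omega>' \<sigma>' K' c)"
      and ran: "f ` Range (data_step \<Omega> \<sigma> K c) = Range (data_step \<Omega>' \<sigma>' K' c)" if "c \<in> C" for c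
      unfolding step[OF that, symmetric] by force+
    have comm: "f (\<sigma> c x) = \<sigma>' c (f x)" if c: "c \<in> C" and x: "x \<in> \<Omega>" for c x
    proof -
      let ?R = "data_step \<Omega> \<sigma> K c" and ?R' = "data_step \<Omega>' \<sigma>' K' c"
      interpret p: partial_bijection \<Omega> ?R using d c by (rule partial_bijection_data_step)
      interpret p': partial_bijection \<Omega>' ?R' using d' c by (rule partial_bijection_data_step)
      have fx: "f x \<in> \<Omega>'" using im x by blast
      have sx: "\<sigma> c x \<in> \<Omega>" using map_data_orbit(3)[OF d c x] .
      have map_step: "map_prod f f ` ?R = ?R'" by (rule step[OF c])
      have rt: "(f y, f z) \<in> ?R'\<^sup>*" if "(y, z) \<in> ?R\<^sup>*" for y z
        using that
      proof (induction rule: rtrancl_induct)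
        case (step y z)
        then have "(f y, f z) \<in> ?R'" using map_step by force
        then show ?case using step.IH by simp
      qed simp
      \<comment> \<open>Since \<open>f\<close> carries paths to paths and preserves their starts and
        ends, it carries closing arcs to closing arcs. Single-valuedness of the closure then forces
        the value.\<close>
      have "(f x, f (\<sigma> c x)) \<in> cycle_closure \<Omega>' ?R'"
      proof (cases "x \<in> Domain ?R")
        case True
        then have "(x, \<sigma> c x) \<in> ?R"
          using p.closure_fun_rel[of "\<sigma> c"] map_data_closure[OF d c] by blast
        then have "(f x, f (\<sigma> c x)) \<in> ?R'" unfolding step[OF c, symmetric] by force
        then show ?thesis by (simp add: cycle_closure_def)
      next
        case False
        then have "\<sigma> c x \<notin> Range ?R" "(\<sigma> c x, x) \<in> ?R\<^sup>*"
          using p.closure_fun_path[of "\<sigma> c" x] map_data_closure[OF d c] x by blast+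
        moreover have "f x \<notin> Domain ?R'" unfolding dom[OF c, symmetric]
          using False inj_on_image_mem_iff[OF inj x] p.subset_carrier
          by (metis (no_types, lifting) Domain_data_step mem_Collect_eq subsetI)
        moreover have "f (\<sigma> c x) \<notin> Range ?R'" unfolding ran[OF c, symmetric]
          using calculation(1) inj_on_image_mem_iff[OF inj sx, of "Range ?R"] p.subset_carrier by blast
        moreover have "f (\<sigma> c x) \<in> \<Omega>'" using im sx by blast
        ultimately show ?thesis using rt fx by (simp add: cycle_closure_def)
      qed
      then show ?thesis using p'.closure_fun_eq[of "\<sigma>' c"] map_data_closure[OF d' c] fx by blast
    qed
    have "f ` K = K'"
    proof (cases "0 \<in> C")
      case True
      have "K = \<Omega> - Domain (data_step \<Omega> \<sigma> K 0)" "K' = \<Omega>' - Domain (data_step \<Omega>' \<sigma>' K' 0)"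
        using K(1,2) by (auto simp: Domain_data_step)
      moreover have "Domain (data_step \<Omega> \<sigma> K 0) \<subseteq> \<Omega>" by (auto simp: Domain_data_step)
      ultimately show ?thesis
        using inj_on_image_set_diff[OF inj, of \<Omega> "Domain (data_step \<Omega> \<sigma> K 0)"] im dom[OF True] by auto
    qed (use K(3) in simp)
    then show ?thesis unfolding data_isomorphic_def using f comm by blast
  qed
qed

section \<open>Coloured graphs as families of partial matchings\<close>

lemma colour_pairing_iff:
  "(b, w) \<in> colour_pairing c G \<longleftrightarrow> (\<exists>e\<in>edges G. colour G e = c \<and> bend G e = b \<and> wend G e = w)"
  by (auto simp: colour_pairing_def)

text \<open>Only the pairings enter, not the names of edges, so the criterion can be compared with
  invariance of sets of pairs.\<close>

lemma cgraph_connected_iff: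
  assumes "\<And>e. e \<in> edges G \<Longrightarrow> bend G e \<in> black G \<and> wend G e \<in> white G"
  shows "cgraph_connected G \<longleftrightarrow> black G \<union> white G \<noteq> {} \<and>
    (\<forall>S\<subseteq>black G \<union> white G. S \<noteq> {} \<longrightarrow>
      (\<forall>c b w. (b, w) \<in> colour_pairing c G \<longrightarrow> (b \<in> S \<longleftrightarrow> w \<in> S)) \<longrightarrow> S = black G \<union> white G)"
proof -
  have *: "(\<forall>c b w. (b, w) \<in> colour_pairing c G \<longrightarrow> (b \<in> S \<longleftrightarrow> w \<in> S)) \<longleftrightarrow>
    (\<forall>e\<in>edges G. bend G e \<in> S \<longleftrightarrow> wend G e \<in> S)" for S
    unfolding colour_pairing_iff by blast
  show ?thesis unfolding cgraph_connected_def *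
    by (subst connected_iff_no_cut) (use assms in auto)
qed

text \<open>The exceptional sets in the definition are taken to be the vertices that the colour 0
  pairing leaves uncovered.\<close>

lemma coloured_graphsI:
  assumes "finite (black G)" "finite (white G)" "finite (edges G)" and disj: "black G \<inter> white G = {}"
    and ends: "\<And>e. e \<in> edges G \<Longrightarrow> bend G e \<in> black G \<and> wend G e \<in> white G \<and> colour G e \<le> D"
    and inj: "\<And>e e'. \<lbrakk>e \<in> edges G; e' \<in> edges G; colour G e = colour G e'; bend G e = bend G e'\<rbrakk> \<Longrightarrow> e = e'"
      "\<And>e e'. \<lbrakk>e \<in> edges G; e' \<in> edges G; colour G e = colour G e'; wend G e = wend G e'\<rbrakk> \<Longrightarrow> e = e'"
    and full: "\<And>c. c \<le> D \<Longrightarrow> c \<noteq> 0 \<Longrightarrow>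
      Domain (colour_pairing c G) = black G \<and> Range (colour_pairing c G) = white G"
    and card: "card (black G - Domain (colour_pairing 0 G)) = q" "card (white G - Range (colour_pairing 0 G)) = q"
    and "cgraph_connected G"
  shows "G \<in> coloured_graphs q D"
proof -
  let ?B = "black G - Domain (colour_pairing 0 G)" and ?W = "white G - Range (colour_pairing 0 G)"
  have incb: "incident G v e \<longleftrightarrow> e \<in> edges G \<and> bend G e = v" if "v \<in> black G" for v e
    using that ends disj by (auto simp: incident_def)
  have incw: "incident G v e \<longleftrightarrow> e \<in> edges G \<and> wend G e = v" if "v \<in> white G" for v e
    using that ends disj by (auto simp: incident_def)
  have b: "if c = 0 \<and> v \<in> ?B \<union> ?W then missing G c v else \<exists>!e. incident G v e \<and> colour G e = c"
    if v: "v \<in> black G" and c: "c \<le> D" for v c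
  proof (cases "v \<in> Domain (colour_pairing c G)")
    case True
    then obtain e where e: "e \<in> edges G" "bend G e = v" "colour G e = c" by (auto simp: colour_pairing_iff)
    have "\<exists>!e. incident G v e \<and> colour G e = c"
      by (rule ex1I[of _ e]) (use e inj(1) incb[OF v] in auto)
    then show ?thesis using True v disj by auto
  next
    case False
    then have "c = 0" using full c v by blast
    moreover have "missing G c v" using False v incb by (auto simp: missing_def Domain_iff colour_pairing_iff)
    ultimately show ?thesis using False v by simp
  qed
  have w: "if c = 0 \<and> v \<in> ?B \<union> ?W then missing G c v else \<exists>!e. incident G v e \<and> colour G e = c"
    if v: "v \<in> white G" and c: "c \<le> D" for v c
  proof (cases "v \<in> Range (colour_pairing c G)")
    case True
    then obtain e where e: "e \<in> edges G" "wend G e = v" "colour G e = c" by (auto simp: colour_pairing_iff)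
    have "\<exists>!e. incident G v e \<and> colour G e = c"
      by (rule ex1I[of _ e]) (use e inj(2) incw[OF v] in auto)
    then show ?thesis using True v disj by auto
  next
    case False
    then have "c = 0" using full c v by blast
    moreover have "missing G c v" using False v incw by (auto simp: missing_def Range_iff colour_pairing_iff)
    ultimately show ?thesis using False v by simp
  qed
  have "\<forall>v \<in> black G \<union> white G. \<forall>c\<in>{0..D}.
      if c = 0 \<and> v \<in> ?B \<union> ?W then missing G c v else \<exists>!e. incident G v e \<and> colour G e = c"
    using b w by (metis UnE atLeastAtMost_iff)
  then have "\<exists>B W. B \<subseteq> black G \<and> W \<subseteq> white G \<and> card B = q \<and> card W = q \<and>
      (\<forall>v \<in> black G \<union> white G. \<forall>c\<in>{0..D}.
         if c = 0 \<and> v \<in> B \<union> W then missing G c v else \<exists>!e. incident G v e \<and> colour G e = c)"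
    using card by (intro exI[of _ ?B] exI[of _ ?W] conjI) auto
  then show ?thesis unfolding coloured_graphs_def using assms(1-3) \<open>cgraph_connected G\<close> disj ends by simp
qed

locale coloured_graph =
  fixes q D :: nat and G :: "('v, 'e) cgraph"
  assumes in_graphs: "G \<in> coloured_graphs q D"
begin

lemma finite_black: "finite (black G)" and finite_white: "finite (white G)"
  and disjoint: "black G \<inter> white G = {}"
  and ends: "e \<in> edges G \<Longrightarrow> bend G e \<in> black G \<and> wend G e \<in> white G \<and> colour G e \<le> D"
  and connected: "cgraph_connected G"
  using in_graphs by (auto simp: coloured_graphs_def)

lemma incident_black: "v \<in> black G \<Longrightarrow> incident G v e \<longleftrightarrow> e \<in> edges G \<and> bend G e = v"
  using ends disjoint by (auto simp: incident_def)

lemma incident_white: "v \<in> white G \<Longrightarrow> incident G v e \<longleftrightarrow> e \<in> edges G \<and> wend G e = v"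
  using ends disjoint by (auto simp: incident_def)

lemma missing_black: "v \<in> black G \<Longrightarrow> missing G c v \<longleftrightarrow> v \<notin> Domain (colour_pairing c G)"
  by (auto simp: missing_def incident_black Domain_iff colour_pairing_iff)

lemma missing_white: "v \<in> white G \<Longrightarrow> missing G c v \<longleftrightarrow> v \<notin> Range (colour_pairing c G)"
  by (auto simp: missing_def incident_white Range_iff colour_pairing_iff)

lemma incident_unique:
  assumes "incident G v e" "incident G v e'" "colour G e = colour G e'"
  shows "e = e'"
proof -
  have "v \<in> black G \<union> white G" "colour G e \<in> {0..D}" using assms(1) ends by (auto simp: incident_def)
  moreover have "\<not> missing G (colour G e) v" using assms(1) by (auto simp: missing_def)
  ultimately have "\<exists>!e'. incident G v e' \<and> colour G e' = colour G e"
    using in_graphs unfolding coloured_graphs_def by (smt (verit) mem_Collect_eq)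
  then show ?thesis using assms by metis
qed

lemma edge_eq_black: "\<lbrakk>e \<in> edges G; e' \<in> edges G; colour G e = colour G e'; bend G e = bend G e'\<rbrakk> \<Longrightarrow> e = e'"
  by (rule incident_unique[of "bend G e"]) (auto simp: incident_def)

lemma edge_eq_white: "\<lbrakk>e \<in> edges G; e' \<in> edges G; colour G e = colour G e'; wend G e = wend G e'\<rbrakk> \<Longrightarrow> e = e'"
  by (rule incident_unique[of "wend G e"]) (auto simp: incident_def)

lemma colour_pairing_subset: "colour_pairing c G \<subseteq> black G \<times> white G"
  using ends by (auto simp: colour_pairing_def)

lemma colour_pairing_le: "p \<in> colour_pairing c G \<Longrightarrow> c \<le> D"
  using ends by (auto simp: colour_pairing_def)

lemma single_valued_pairing: "single_valued (colour_pairing c G)"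
  unfolding single_valued_def colour_pairing_iff using edge_eq_black by metis

lemma single_valued_pairing_converse: "single_valued ((colour_pairing c G)\<inverse>)"
  unfolding single_valued_def converse_iff colour_pairing_iff using edge_eq_white by metis

lemma missing_sets:
  obtains B W where "B \<subseteq> black G" "W \<subseteq> white G" "card B = q" "card W = q"
    "\<And>v c. v \<in> black G \<union> white G \<Longrightarrow> c \<le> D \<Longrightarrow> missing G c v \<longleftrightarrow> c = 0 \<and> v \<in> B \<union> W"
proof -
  obtain B W where BW: "B \<subseteq> black G" "W \<subseteq> white G" "card B = q" "card W = q"
    and *: "\<forall>v \<in> black G \<union> white G. \<forall>c\<in>{0..D}.
           if c = 0 \<and> v \<in> B \<union> W then missing G c v
           else \<exists>!e. incident G v e \<and> colour G e = c"
    using in_graphs unfolding coloured_graphs_def by blast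
  have "missing G c v \<longleftrightarrow> c = 0 \<and> v \<in> B \<union> W" if "v \<in> black G \<union> white G" "c \<le> D" for v c
  proof (cases "c = 0 \<and> v \<in> B \<union> W")
    case True
    then show ?thesis using *[rule_format, OF that(1), of c] that(2) by simp
  next
    case False
    then have "\<exists>!e. incident G v e \<and> colour G e = c"
      using *[rule_format, OF that(1), of c] that(2) by simp
    then show ?thesis using False by (auto simp: missing_def)
  qed
  then show thesis using that BW by blast
qed

lemma pairing_full:
  assumes "c \<le> D" "c \<noteq> 0"
  shows "Domain (colour_pairing c G) = black G" "Range (colour_pairing c G) = white G"
proof -
  have "\<not> missing G c v" if "v \<in> black G \<union> white G" for v
    by (rule missing_sets) (use that assms in blast)
  then show "Domain (colour_pairing c G) = black G" "Range (colour_pairing c G) = white G"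
    using missing_black missing_white colour_pairing_subset by blast+
qed

lemma card_missing:
  "card (black G - Domain (colour_pairing 0 G)) = q" "card (white G - Range (colour_pairing 0 G)) = q"
proof -
  obtain B W where BW: "B \<subseteq> black G" "W \<subseteq> white G" "card B = q" "card W = q"
    and m: "\<And>v c. v \<in> black G \<union> white G \<Longrightarrow> c \<le> D \<Longrightarrow> missing G c v \<longleftrightarrow> c = 0 \<and> v \<in> B \<union> W"
    using missing_sets by metis
  have "black G - Domain (colour_pairing 0 G) = {v \<in> black G. missing G 0 v}"
    using missing_black by blast
  also have "\<dots> = B" using m[of _ 0] BW(1,2) disjoint by blast
  finally show "card (black G - Domain (colour_pairing 0 G)) = q" using BW(3) by simp
  have "white G - Range (colour_pairing 0 G) = {v \<in> white G. missing G 0 v}"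
    using missing_white by blast
  also have "\<dots> = W" using m[of _ 0] BW(1,2) disjoint by blast
  finally show "card (white G - Range (colour_pairing 0 G)) = q" using BW(4) by simp
qed

end

text \<open>Parallel edges differ in colour, and an edge is determined by its colour and black end.
  A vertex bijection respecting every pairing therefore dictates the bijection of edges.\<close>

lemma cgraph_isomorphic_iff_pairings:
  assumes "G \<in> coloured_graphs q D" "H \<in> coloured_graphs q' D'"
  shows "cgraph_isomorphic G H \<longleftrightarrow>
    (\<exists>f. bij_betw f (black G \<union> white G) (black H \<union> white H) \<and>
     f ` black G = black H \<and> f ` white G = white H \<and>
     (\<forall>c. map_prod f f ` colour_pairing c G = colour_pairing c H))"
    (is "?L \<longleftrightarrow> ?R")
proof
  interpret G: coloured_graph q D G using assms(1) by unfold_locales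
  interpret H: coloured_graph q' D' H using assms(2) by unfold_locales
  show ?R if ?L
  proof -
    from that obtain f g where f: "bij_betw f (black G \<union> white G) (black H \<union> white H)"
      "f ` black G = black H" "f ` white G = white H" and bij: "bij_betw g (edges G) (edges H)"
      and e: "\<forall>e\<in>edges G. bend H (g e) = f (bend G e) \<and> wend H (g e) = f (wend G e) \<and>
        colour H (g e) = colour G e"
      unfolding cgraph_isomorphic_def by blast
    from bij have g: "g ` edges G = edges H" by (rule bij_betw_imp_surj_on)
    have "map_prod f f ` colour_pairing c G = colour_pairing c H" for c
    proof -
      have im: "colour_pairing c K = (\<lambda>e. (bend K e, wend K e)) ` {e \<in> edges K. colour K e = c}"
        for K :: "('x, 'y) cgraph" by (auto simp: colour_pairing_def)
      have "map_prod f f ` colour_pairing c G = (\<lambda>e. (bend H e, wend H e)) ` g ` {e \<in> edges G. colour G e = c}"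
        unfolding im image_image using e by (intro image_cong) auto
      also have "g ` {e \<in> edges G. colour G e = c} = {e \<in> edges H. colour H e = c}"
        unfolding g[symmetric] using e by auto
      finally show ?thesis unfolding im .
    qed
    then show ?thesis using f by blast
  qed
  show ?L if ?R
  proof -
    from that obtain f where f: "bij_betw f (black G \<union> white G) (black H \<union> white H)"
      "f ` black G = black H" "f ` white G = white H"
      and p: "\<And>c. map_prod f f ` colour_pairing c G = colour_pairing c H" by blast
    have inj: "inj_on f (black G \<union> white G)" using f(1) by (simp add: bij_betw_def)
    have "\<exists>e'. e' \<in> edges H \<and> bend H e' = f (bend G e) \<and> wend H e' = f (wend G e) \<and> colour H e' = colour G e"
      if "e \<in> edges G" for e
    proof -
      have "(f (bend G e), f (wend G e)) \<in> colour_pairing (colour G e) H"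
        unfolding p[symmetric] using that by (intro image_eqI[of _ _ "(bend G e, wend G e)"]) (auto simp: colour_pairing_iff)
      then show ?thesis unfolding colour_pairing_iff by blast
    qed
    then obtain g where g: "\<And>e. e \<in> edges G \<Longrightarrow> g e \<in> edges H \<and> bend H (g e) = f (bend G e) \<and>
        wend H (g e) = f (wend G e) \<and> colour H (g e) = colour G e"
      by metis
    have "bij_betw g (edges G) (edges H)" unfolding bij_betw_def
    proof
      show "inj_on g (edges G)"
      proof (rule inj_onI)
        fix e e' assume e: "e \<in> edges G" "e' \<in> edges G" "g e = g e'"
        then have "f (bend G e) = f (bend G e')" "colour G e = colour G e'" using g by metis+
        then show "e = e'" using G.edge_eq_black e G.ends inj by (metis UnCI inj_onD)
      qed
      have "e' \<in> g ` edges G" if e': "e' \<in> edges H" for e'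
      proof -
        have "(bend H e', wend H e') \<in> map_prod f f ` colour_pairing (colour H e') G"
          unfolding p colour_pairing_iff using e' by blast
        then obtain e where e: "e \<in> edges G" "colour G e = colour H e'" "f (bend G e) = bend H e'"
          by (auto simp: colour_pairing_def)
        then have "g e = e'" using g[OF e(1)] e' by (intro H.edge_eq_black) auto
        then show ?thesis using e(1) by blast
      qed
      then show "g ` edges G = edges H" using g by blast
    qed
    then show ?thesis unfolding cgraph_isomorphic_def using f g by blast
  qed
qed

section \<open>The pairs of colour \<open>i\<close>\<close>

text \<open>This is the partial form of the permutation of the pairs for colour \<open>c\<close>,
  read off the graph before any marked edge is added.\<close>

definition pair_step :: "nat \<Rightarrow> ('v, 'e) cgraph \<Rightarrow> nat \<Rightarrow> (('v \<times> 'v) \<times> ('v \<times> 'v)) set" where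
  "pair_step i G c = {(\<pi>, \<pi>'). \<pi> \<in> colour_pairing i G \<and> \<pi>' \<in> colour_pairing i G \<and>
     (fst \<pi>, snd \<pi>') \<in> colour_pairing c G}"

locale paired_graph = coloured_graph +
  fixes i :: nat
  assumes i_le: "i \<le> D" and i_pos: "q > 0 \<longrightarrow> i \<noteq> 0"
begin

abbreviation "\<Omega> \<equiv> colour_pairing i G"
abbreviation "C \<equiv> {0..D} - {i}"
abbreviation "step \<equiv> pair_step i G"

text \<open>These pairs are the ends of the paths of \<open>step 0\<close>; the added edges leave
  from their black vertices.\<close>

definition "gaps = {\<pi> \<in> \<Omega>. fst \<pi> \<notin> Domain (colour_pairing 0 G)}"

definition "pair_rot = pair_perm (add_marked_edges C (delete_colour i G) \<Omega>) \<Omega>"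

text \<open>For \<open>i = 0\<close> the hypothesis forces \<open>q = 0\<close>, so no vertex lacks
  an edge of colour \<open>i\<close>; any other colour is present at every vertex.\<close>

lemma fst_pairs: "fst ` \<Omega> = black G" and snd_pairs: "snd ` \<Omega> = white G"
proof -
  have "Domain \<Omega> = black G \<and> Range \<Omega> = white G"
  proof (cases "i = 0")
    case True
    then have "card (black G - Domain \<Omega>) = 0" "card (white G - Range \<Omega>) = 0"
      using card_missing i_pos by auto
    then show ?thesis
      using finite_black finite_white colour_pairing_subset[of i] by auto
  next
    case False
    then show ?thesis using pairing_full i_le by blast
  qed
  then show "fst ` \<Omega> = black G" "snd ` \<Omega> = white G" by (simp_all add: Domain_fst Range_snd)
qed

lemma inj_fst: "inj_on fst \<Omega>" and inj_snd: "inj_on snd \<Omega>"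
  using single_valued_pairing[of i] single_valued_pairing_converse[of i]
  by (auto intro!: inj_onI dest: single_valuedD)

lemma ends_bw: "e \<in> edges G \<Longrightarrow> bend G e \<in> black G \<and> wend G e \<in> white G"
  using ends by blast

lemma no_cut:
  assumes "S \<subseteq> black G \<union> white G" "S \<noteq> {}"
    and "\<And>c b w. (b, w) \<in> colour_pairing c G \<Longrightarrow> b \<in> S \<longleftrightarrow> w \<in> S"
  shows "S = black G \<union> white G"
proof -
  have "\<forall>S\<subseteq>black G \<union> white G. S \<noteq> {} \<longrightarrow>
      (\<forall>c b w. (b, w) \<in> colour_pairing c G \<longrightarrow> (b \<in> S \<longleftrightarrow> w \<in> S)) \<longrightarrow> S = black G \<union> white G"
    using connected by (simp only: cgraph_connected_iff ends_bw) (erule conjunct2)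
  then show ?thesis using assms by blast
qed

lemma finite_pairs: "finite \<Omega>"
  using colour_pairing_subset finite_black finite_white by (meson finite_SigmaI finite_subset)

text \<open>Each vertex is an end of a pair, so every edge is seen as a step between pairs and each
  pairing can be recovered from the steps.\<close>

lemma colour_pairing_step: "colour_pairing c G = (\<lambda>(\<pi>, \<pi>'). (fst \<pi>, snd \<pi>')) ` step c"
proof
  show "colour_pairing c G \<subseteq> (\<lambda>(\<pi>, \<pi>'). (fst \<pi>, snd \<pi>')) ` step c"
  proof clarify
    fix b w assume bw: "(b, w) \<in> colour_pairing c G"
    then have "b \<in> fst ` \<Omega>" "w \<in> snd ` \<Omega>" using colour_pairing_subset fst_pairs snd_pairs by blast+
    then obtain \<pi> \<pi>' where "\<pi> \<in> \<Omega>" "b = fst \<pi>" "\<pi>' \<in> \<Omega>" "w = snd \<pi>'" by blast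
    then show "(b, w) \<in> (\<lambda>(\<pi>, \<pi>'). (fst \<pi>, snd \<pi>')) ` step c"
      using bw by (intro image_eqI[of _ _ "(\<pi>, \<pi>')"]) (auto simp: pair_step_def)
  qed
qed (auto simp: pair_step_def)

lemma Domain_step: "Domain (step c) = {\<pi> \<in> \<Omega>. fst \<pi> \<in> Domain (colour_pairing c G)}"
proof
  show "{\<pi> \<in> \<Omega>. fst \<pi> \<in> Domain (colour_pairing c G)} \<subseteq> Domain (step c)"
  proof
    fix \<pi> assume "\<pi> \<in> {\<pi> \<in> \<Omega>. fst \<pi> \<in> Domain (colour_pairing c G)}"
    then obtain w where w: "\<pi> \<in> \<Omega>" "(fst \<pi>, w) \<in> colour_pairing c G" by blast
    then have "w \<in> snd ` \<Omega>" using snd_pairs colour_pairing_subset by blast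
    then obtain \<pi>' where "\<pi>' \<in> \<Omega>" "w = snd \<pi>'" by blast
    then have "(\<pi>, \<pi>') \<in> step c" using w by (simp add: pair_step_def)
    then show "\<pi> \<in> Domain (step c)" by blast
  qed
qed (auto simp: pair_step_def)

lemma Range_step: "Range (step c) = {\<pi> \<in> \<Omega>. snd \<pi> \<in> Range (colour_pairing c G)}"
proof
  show "{\<pi> \<in> \<Omega>. snd \<pi> \<in> Range (colour_pairing c G)} \<subseteq> Range (step c)"
  proof
    fix \<pi> assume "\<pi> \<in> {\<pi> \<in> \<Omega>. snd \<pi> \<in> Range (colour_pairing c G)}"
    then obtain b where b: "\<pi> \<in> \<Omega>" "(b, snd \<pi>) \<in> colour_pairing c G" by blast
    then have "b \<in> fst ` \<Omega>" using fst_pairs colour_pairing_subset by blast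
    then obtain \<pi>' where "\<pi>' \<in> \<Omega>" "b = fst \<pi>'" by blast
    then have "(\<pi>', \<pi>) \<in> step c" using b by (simp add: pair_step_def)
    then show "\<pi> \<in> Range (step c)" by blast
  qed
qed (auto simp: pair_step_def)

lemma partial_bijection_step: "partial_bijection \<Omega> (step c)"
proof
  show "single_valued (step c)"
  proof (rule single_valuedI)
    fix x y z assume "(x, y) \<in> step c" "(x, z) \<in> step c"
    then have "y \<in> \<Omega>" "z \<in> \<Omega>" "snd y = snd z"
      using single_valued_pairing by (auto simp: pair_step_def dest: single_valuedD)
    then show "y = z" using inj_snd by (meson inj_onD)
  qed
  show "single_valued ((step c)\<inverse>)"
  proof (rule single_valuedI)
    fix x y z assume "(x, y) \<in> (step c)\<inverse>" "(x, z) \<in> (step c)\<inverse>"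
    then have yz: "y \<in> \<Omega>" "z \<in> \<Omega>" "(snd x, fst y) \<in> (colour_pairing c G)\<inverse>"
      "(snd x, fst z) \<in> (colour_pairing c G)\<inverse>"
      by (auto simp: pair_step_def)
    then have "fst y = fst z" using single_valued_pairing_converse by (meson single_valuedD)
    then show "y = z" using inj_fst yz(1,2) by (meson inj_onD)
  qed
qed (auto simp: finite_pairs pair_step_def)

section \<open>Marked edges as closing arcs\<close>

text \<open>The order is reversed: an alternating path traverses colour 0 edges from white to black,
  whereas \<open>step 0\<close> follows them from black to white. A path leaving the black vertex of
  \<open>\<pi>\<close> thus runs backwards from \<open>\<pi>\<close> to
  \<open>\<pi>'\<close>.\<close>

lemma alternating_path_iff:
  assumes i: "i \<noteq> 0" and \<pi>: "\<pi> \<in> \<Omega>" "\<pi>' \<in> \<Omega>"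
  shows "alternating_path (delete_colour i G) \<Omega> (fst \<pi>) (snd \<pi>') \<longleftrightarrow> (\<pi>', \<pi>) \<in> (step 0)\<^sup>*"
proof
  \<comment> \<open>The induction is over vertices, so the pairs at both ends are left existential;
    uniqueness of the pair at a vertex identifies them afterwards.\<close>
  have "\<exists>\<rho>\<in>\<Omega>. \<exists>\<rho>'\<in>\<Omega>. fst \<rho> = b \<and> snd \<rho>' = w \<and> (\<rho>', \<rho>) \<in> (step 0)\<^sup>*"
    if "alternating_path (delete_colour i G) \<Omega> b w" for b w
    using that
  proof induction
    case (pair b w)
    then show ?case by (intro bexI[of _ "(b, w)"]) auto
  next
    case (step b w e w')
    then obtain \<rho> \<rho>' where \<rho>: "\<rho> \<in> \<Omega>" "\<rho>' \<in> \<Omega>" "fst \<rho> = b" "snd \<rho>' = w" "(\<rho>', \<rho>) \<in> (step 0)\<^sup>*"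
      by blast
    have e: "e \<in> edges G" "bend (delete_colour i G) e = bend G e" "wend G e = w" "colour G e = 0"
      using step.hyps by (auto simp: delete_colour_def)
    let ?\<rho> = "(bend G e, w')"
    have \<Omega>: "?\<rho> \<in> \<Omega>" using step.hyps e(2) by simp
    have "(bend G e, w) \<in> colour_pairing 0 G" unfolding colour_pairing_iff using e by blast
    then have "(?\<rho>, \<rho>') \<in> step 0" using \<Omega> \<rho>(2,4) by (simp add: pair_step_def)
    then have "(?\<rho>, \<rho>) \<in> (step 0)\<^sup>*" using \<rho>(5) by (rule converse_rtrancl_into_rtrancl)
    then show ?case using \<rho>(1,3) \<Omega> by (intro bexI[of _ \<rho>] bexI[of _ ?\<rho>]) auto
  qed
  then show "(\<pi>', \<pi>) \<in> (step 0)\<^sup>*" if "alternating_path (delete_colour i G) \<Omega> (fst \<pi>) (snd \<pi>')"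
    using that \<pi> inj_fst inj_snd by (metis inj_onD)
next
  assume "(\<pi>', \<pi>) \<in> (step 0)\<^sup>*"
  then show "alternating_path (delete_colour i G) \<Omega> (fst \<pi>) (snd \<pi>')"
  proof (induction rule: converse_rtrancl_induct)
    case base
    then show ?case using \<pi> by (auto intro: alternating_path.pair)
  next
    case (step y z)
    then obtain e where e: "e \<in> edges G" "colour G e = 0" "bend G e = fst y" "wend G e = snd z"
      and y: "y \<in> \<Omega>" by (auto simp: pair_step_def colour_pairing_iff)
    show ?case
    proof (rule alternating_path.step[OF step.IH, of e])
      show "e \<in> edges (delete_colour i G)" using e i by (simp add: delete_colour_def)
      show "(bend (delete_colour i G) e, snd y) \<in> \<Omega>" using e(3) y by (simp add: delete_colour_def)
    qed (use e in \<open>simp_all add: delete_colour_def\<close>)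
  qed
qed

lemma missing_delete: "i \<noteq> c \<Longrightarrow> missing (delete_colour i G) c v \<longleftrightarrow> missing G c v"
  by (auto simp: missing_def incident_def delete_colour_def)

lemma open_path_ends_iff:
  assumes i: "i \<noteq> 0" and \<pi>: "\<pi> \<in> \<Omega>" "\<pi>' \<in> \<Omega>"
  shows "(fst \<pi>, snd \<pi>') \<in> open_path_ends (delete_colour i G) \<Omega> \<longleftrightarrow>
    \<pi> \<notin> Domain (step 0) \<and> \<pi>' \<notin> Range (step 0) \<and> (\<pi>', \<pi>) \<in> (step 0)\<^sup>*"
proof -
  have bw: "fst \<pi> \<in> black G" "snd \<pi>' \<in> white G" using \<pi> fst_pairs snd_pairs by blast+
  have "(fst \<pi>, snd \<pi>') \<in> open_path_ends (delete_colour i G) \<Omega> \<longleftrightarrow>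
    missing G 0 (fst \<pi>) \<and> missing G 0 (snd \<pi>') \<and> (\<pi>', \<pi>) \<in> (step 0)\<^sup>*"
    using bw missing_delete[OF i] alternating_path_iff[OF i \<pi>]
    by (simp add: open_path_ends_def delete_colour_def)
  also have "missing G 0 (fst \<pi>) \<longleftrightarrow> \<pi> \<notin> Domain (step 0)"
    using missing_black[OF bw(1)] \<pi>(1) by (simp add: Domain_step)
  also have "missing G 0 (snd \<pi>') \<longleftrightarrow> \<pi>' \<notin> Range (step 0)"
    using missing_white[OF bw(2)] \<pi>(2) by (simp add: Range_step)
  finally show ?thesis .
qed

lemma Domain_step_full: "\<lbrakk>c \<le> D; c \<noteq> 0\<rbrakk> \<Longrightarrow> Domain (step c) = \<Omega>"
  using pairing_full(1) fst_pairs by (auto simp: Domain_step)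

text \<open>At colour 0 the added edges are exactly the closing arcs. At every other colour the step
  is total, so the closure adds nothing, just as no edge of that colour is added.\<close>

lemma completed_edge_iff:
  assumes c: "c \<in> C" and \<pi>: "\<pi> \<in> \<Omega>" "\<pi>' \<in> \<Omega>"
  shows "(\<exists>e\<in>edges (add_marked_edges C (delete_colour i G) \<Omega>).
      colour (add_marked_edges C (delete_colour i G) \<Omega>) e = c \<and>
      bend (add_marked_edges C (delete_colour i G) \<Omega>) e = fst \<pi> \<and>
      wend (add_marked_edges C (delete_colour i G) \<Omega>) e = snd \<pi>') \<longleftrightarrow>
    (\<pi>, \<pi>') \<in> cycle_closure \<Omega> (step c)" (is "?L \<longleftrightarrow> _")
proof -
  have ends_eq: "(\<exists>e\<in>X. fst e = b \<and> snd e = w) \<longleftrightarrow> (b, w) \<in> X" for X :: "('v \<times> 'v) set" and b w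
    by force
  have "?L \<longleftrightarrow> (fst \<pi>, snd \<pi>') \<in> colour_pairing c G \<or>
      c = 0 \<and> (fst \<pi>, snd \<pi>') \<in> open_path_ends (delete_colour i G) \<Omega>"
    using c by (auto simp: add_marked_edges_def Let_def bex_Un colour_pairing_iff delete_colour_def ends_eq)
  also have "(fst \<pi>, snd \<pi>') \<in> colour_pairing c G \<longleftrightarrow> (\<pi>, \<pi>') \<in> step c"
    using \<pi> by (simp add: pair_step_def)
  also have "c = 0 \<and> (fst \<pi>, snd \<pi>') \<in> open_path_ends (delete_colour i G) \<Omega> \<longleftrightarrow>
      \<pi> \<notin> Domain (step c) \<and> \<pi>' \<notin> Range (step c) \<and> (\<pi>', \<pi>) \<in> (step c)\<^sup>*"
  proof (cases "c = 0")
    case True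
    then have "i \<noteq> 0" using c by simp
    then show ?thesis using open_path_ends_iff \<pi> True by simp
  next
    case False
    then show ?thesis using Domain_step_full[of c] c \<pi>(1) by simp
  qed
  finally show ?thesis using \<pi> by (auto simp: cycle_closure_def)
qed

text \<open>The definite description in \<open>pair_perm\<close> is legitimate because the closure
  is total and single-valued. From here on only this property of \<open>pair_rot\<close>
  matters.\<close>

lemma pair_rot_closure:
  assumes c: "c \<in> C" and \<pi>: "\<pi> \<in> \<Omega>"
  shows "(\<pi>, pair_rot c \<pi>) \<in> cycle_closure \<Omega> (step c)"
proof -
  interpret p: partial_bijection \<Omega> "step c" by (rule partial_bijection_step)
  have "pair_rot c \<pi> = (THE \<pi>'. \<pi>' \<in> \<Omega> \<and> (\<pi>, \<pi>') \<in> cycle_closure \<Omega> (step c))"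
    unfolding pair_rot_def pair_perm_def using completed_edge_iff[OF c \<pi>] by (metis (no_types, lifting))
  moreover have "\<exists>!\<pi>'. \<pi>' \<in> \<Omega> \<and> (\<pi>, \<pi>') \<in> cycle_closure \<Omega> (step c)"
    using p.cycle_closure_total[OF \<pi>] p.cycle_closure_carrier p.single_valued_cycle_closure
    by (auto dest: single_valuedD)
  ultimately show ?thesis using theI' by (metis (mono_tags, lifting))
qed

lemma gaps_Domain: "gaps = \<Omega> - Domain (step 0)"
  by (auto simp: gaps_def Domain_step)

lemma gaps_empty: "0 \<notin> C \<Longrightarrow> gaps = {}"
proof -
  assume "0 \<notin> C"
  then have "i = 0" by simp
  then show ?thesis unfolding gaps_def Domain_fst by blast
qed

text \<open>The two records agree by construction except in how the marks are described: by black
  ends of added edges, or by \<open>gaps\<close>.\<close>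

lemma Psi_colour_canonical: "Psi_colour D i G = canonical_map C \<Omega> pair_rot gaps"
proof -
  have "(\<exists>e\<in>marked_edges (add_marked_edges C (delete_colour i G) \<Omega>).
      bend (add_marked_edges C (delete_colour i G) \<Omega>) e = fst \<pi>) \<longleftrightarrow> \<pi> \<in> gaps"
    (is "?L \<longleftrightarrow> _") if \<pi>: "\<pi> \<in> \<Omega>" for \<pi>
  proof (cases "0 \<in> C")
    case False
    then show ?thesis using gaps_empty by (simp add: add_marked_edges_def Let_def)
  next
    case True
    then have i: "i \<noteq> 0" by simp
    interpret p: partial_bijection \<Omega> "step 0" by (rule partial_bijection_step)
    have "?L \<longleftrightarrow> (\<exists>p\<in>open_path_ends (delete_colour i G) \<Omega>. fst p = fst \<pi>)"
      using i by (simp add: add_marked_edges_def Let_def)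
    also have "\<dots> \<longleftrightarrow> (\<exists>w. (fst \<pi>, w) \<in> open_path_ends (delete_colour i G) \<Omega>)"
      by (metis fst_conv prod.collapse)
    also have "\<dots> \<longleftrightarrow> (\<exists>\<pi>'\<in>\<Omega>. (fst \<pi>, snd \<pi>') \<in> open_path_ends (delete_colour i G) \<Omega>)"
    proof -
      have "w \<in> snd ` \<Omega>" if "(b, w) \<in> open_path_ends (delete_colour i G) \<Omega>" for b w
        using that snd_pairs by (simp add: open_path_ends_def delete_colour_def)
      then show ?thesis by blast
    qed
    \<comment> \<open>Following the path back from an end reaches a start, so every gap does receive
      an added edge.\<close>
    also have "\<dots> \<longleftrightarrow> \<pi> \<notin> Domain (step 0)"
      using open_path_ends_iff[OF i \<pi>] p.path_start[OF \<pi>] by blast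
    finally show ?thesis using \<pi> by (simp add: gaps_Domain)
  qed
  moreover have "gaps \<subseteq> \<Omega>" by (auto simp: gaps_def)
  ultimately have "{((0::nat, \<pi>), (0::nat, pair_rot 0 \<pi>)) | \<pi>. \<pi> \<in> \<Omega> \<and>
        (\<exists>e\<in>marked_edges (add_marked_edges C (delete_colour i G) \<Omega>).
          bend (add_marked_edges C (delete_colour i G) \<Omega>) e = fst \<pi>)} =
      {((0, \<pi>), (0, pair_rot 0 \<pi>)) | \<pi>. \<pi> \<in> gaps}" by blast
  then show ?thesis
    unfolding Psi_colour_def Psi_def Psi_marked_def canonical_map_def Let_def pair_rot_def[symmetric]
    by simp
qed

text \<open>Gaps correspond to the black vertices without colour 0, which gives their number, and
  each cycle closes up at most one path. Transitivity comes from turning an invariant set of pairs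
  into an uncrossed set of vertices.\<close>

lemma map_data_pairs: "map_data q C \<Omega> pair_rot gaps"
  unfolding map_data_def
proof (intro conjI ballI allI impI)
  show "bij_betw (pair_rot c) \<Omega> \<Omega>" if "c \<in> C" for c
    using partial_bijection.bij_closure_fun[OF partial_bijection_step[of c]] pair_rot_closure[OF that] .
  show "\<Omega> \<noteq> {}"
  proof -
    have "black G \<union> white G \<noteq> {}" using connected by (simp only: cgraph_connected_iff ends_bw) simp
    then show ?thesis using fst_pairs snd_pairs by blast
  qed
  show "gaps = {}" if "0 \<notin> C" using gaps_empty that .
  show "card gaps = q"
  proof -
    have "black G - Domain (colour_pairing 0 G) = fst ` gaps"
      unfolding gaps_def fst_pairs[symmetric] by blast
    moreover have "inj_on fst gaps" using inj_fst by (rule inj_on_subset) (auto simp: gaps_def)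
    ultimately show ?thesis using card_missing(1) by (simp add: card_image)
  qed
  show "x = y" if xy: "x \<in> gaps" "y \<in> gaps" "y \<in> orbit (pair_rot 0) x" for x y
  proof -
    have "0 \<in> C" using xy(1) gaps_empty by blast
    then show ?thesis
      using partial_bijection.orbit_gap_unique[OF partial_bijection_step[of 0] pair_rot_closure]
        xy unfolding gaps_Domain by blast
  qed
  show "A = \<Omega>" if A: "A \<subseteq> \<Omega>" "A \<noteq> {}" and cl: "\<forall>c\<in>C. pair_rot c ` A \<subseteq> A" for A
  proof -
    \<comment> \<open>Since the pairs partition the vertices, membership of a vertex in
      \<open>?S\<close> is the same as membership of its pair in \<open>A\<close>.\<close>
    let ?S = "fst ` A \<union> snd ` A"
    have sub: "fst ` A \<subseteq> black G" "snd ` A \<subseteq> white G" using A(1) fst_pairs snd_pairs by blast+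
    have memb: "fst \<pi> \<in> ?S \<longleftrightarrow> \<pi> \<in> A" and memw: "snd \<pi> \<in> ?S \<longleftrightarrow> \<pi> \<in> A" if \<pi>: "\<pi> \<in> \<Omega>" for \<pi>
    proof -
      have "fst \<pi> \<notin> white G" "snd \<pi> \<notin> black G" using \<pi> fst_pairs snd_pairs disjoint by blast+
      then show "fst \<pi> \<in> ?S \<longleftrightarrow> \<pi> \<in> A" "snd \<pi> \<in> ?S \<longleftrightarrow> \<pi> \<in> A"
        using sub inj_on_image_mem_iff[OF inj_fst \<pi> A(1)] inj_on_image_mem_iff[OF inj_snd \<pi> A(1)]
        by blast+
    qed
    have closed: "b \<in> ?S \<longleftrightarrow> w \<in> ?S" if bw: "(b, w) \<in> colour_pairing c G" for c b w
    proof (cases "c = i")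
      case True
      then show ?thesis using memb[of "(b, w)"] memw[of "(b, w)"] bw by simp
    next
      case False
      then have c: "c \<in> C" using colour_pairing_le[OF bw] by simp
      from bw obtain \<pi> \<pi>' where p: "(\<pi>, \<pi>') \<in> step c" "b = fst \<pi>" "w = snd \<pi>'"
        unfolding colour_pairing_step[of c] by auto
      then have \<Omega>: "\<pi> \<in> \<Omega>" "\<pi>' \<in> \<Omega>" by (auto simp: pair_step_def)
      have "\<forall>(x, y)\<in>step c. x \<in> A \<longleftrightarrow> y \<in> A"
        using partial_bijection.closed_iff_closure_fun_closed[OF partial_bijection_step pair_rot_closure A(1)]
          c cl by blast
      then have "\<pi> \<in> A \<longleftrightarrow> \<pi>' \<in> A" using p(1) by blast
      then show ?thesis using memb[OF \<Omega>(1)] memw[OF \<Omega>(2)] p(2,3) by simp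
    qed
    have "?S \<subseteq> black G \<union> white G" "?S \<noteq> {}" using sub A(2) by blast+
    then have S: "?S = black G \<union> white G" using closed by (rule no_cut)
    have "\<pi> \<in> A" if \<pi>: "\<pi> \<in> \<Omega>" for \<pi>
    proof -
      have "fst \<pi> \<in> ?S" unfolding S using \<pi> fst_pairs by blast
      then show ?thesis using memb[OF \<pi>] by blast
    qed
    then show ?thesis using A(1) by blast
  qed
qed (auto simp: finite_pairs gaps_def)

text \<open>Removing the values at the gaps undoes the closure, because the gaps are exactly where
  the colour 0 step was undefined.\<close>

lemma data_step_pairs:
  assumes c: "c \<in> C"
  shows "data_step \<Omega> pair_rot gaps c = step c"
proof -
  interpret p: partial_bijection \<Omega> "step c" by (rule partial_bijection_step)
  have "\<Omega> - Domain (step c) = {\<pi> \<in> \<Omega>. c = 0 \<and> \<pi> \<in> gaps}"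
    using c Domain_step_full[of c] by (cases "c = 0") (auto simp: gaps_Domain)
  moreover have "Domain (step c) \<subseteq> \<Omega>" by (auto simp: Domain_step)
  ultimately have "Domain (step c) = {\<pi> \<in> \<Omega>. \<not> (c = 0 \<and> \<pi> \<in> gaps)}" by blast
  then have "(x, y) \<in> step c \<longleftrightarrow> x \<in> \<Omega> \<and> \<not> (c = 0 \<and> x \<in> gaps) \<and> y = pair_rot c x" for x y
    using p.rel_iff_closure_fun[OF pair_rot_closure[OF c], of x y] by blast
  then have "p \<in> step c \<longleftrightarrow> p \<in> data_step \<Omega> pair_rot gaps c" for p
    unfolding data_step_def by (cases p rule: prod.exhaust) (auto simp del: split_paired_Ex)
  then show ?thesis by blast
qed

lemma Psi_colour_in_stacked_maps: "Psi_colour D i G \<in> stacked_maps q C"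
  unfolding Psi_colour_canonical by (rule canonical_map_in_stacked_maps[OF map_data_pairs]) simp

end

section \<open>Comparing isomorphisms on the two sides\<close>

text \<open>A vertex is the black or the white end of exactly one pair, so bijections of vertices
  that respect colour \<open>i\<close> correspond to bijections of pairs.\<close>

lemma cgraph_isomorphic_iff_pair_step:
  assumes "paired_graph q D G i" "paired_graph q D H i"
  shows "cgraph_isomorphic G H \<longleftrightarrow>
    (\<exists>f. bij_betw f (colour_pairing i G) (colour_pairing i H) \<and>
      (\<forall>c\<in>{0..D} - {i}. map_prod f f ` pair_step i G c = pair_step i H c))" (is "_ \<longleftrightarrow> ?R")
proof
  interpret G: paired_graph q D G i by (rule assms(1))
  interpret H: paired_graph q D H i by (rule assms(2))
  note iff = cgraph_isomorphic_iff_pairings[OF G.in_graphs H.in_graphs]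
  show ?R if "cgraph_isomorphic G H"
  proof -
    from that[unfolded iff] obtain F where F: "bij_betw F (black G \<union> white G) (black H \<union> white H)"
      and p: "\<And>c. map_prod F F ` colour_pairing c G = colour_pairing c H" by blast
    let ?f = "map_prod F F"
    have inj: "inj_on F (black G \<union> white G)" using F by (simp add: bij_betw_def)
    have V: "fst \<pi> \<in> black G \<union> white G" "snd \<pi> \<in> black G \<union> white G" if "\<pi> \<in> colour_pairing c G" for \<pi> c
      using that G.colour_pairing_subset[of c] by auto
    have "inj_on ?f (colour_pairing i G)"
    proof (rule inj_onI)
      fix x y assume xy: "x \<in> colour_pairing i G" "y \<in> colour_pairing i G" "?f x = ?f y"
      then have "F (fst x) = F (fst y)" "F (snd x) = F (snd y)" by (metis fst_map_prod snd_map_prod)+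
      then have "fst x = fst y" "snd x = snd y" using inj V xy(1,2) by (meson inj_onD)+
      then show "x = y" by (rule prod_eqI)
    qed
    then have "bij_betw ?f (colour_pairing i G) (colour_pairing i H)" using p by (simp add: bij_betw_def)
    moreover have "map_prod ?f ?f ` pair_step i G c = pair_step i H c" for c
    proof
      show "map_prod ?f ?f ` pair_step i G c \<subseteq> pair_step i H c"
        unfolding pair_step_def p[symmetric] by force
      show "pair_step i H c \<subseteq> map_prod ?f ?f ` pair_step i G c"
      proof clarify
        fix a b a' b' assume "((a, b), (a', b')) \<in> pair_step i H c"
        then have m: "(a, b) \<in> ?f ` colour_pairing i G" "(a', b') \<in> ?f ` colour_pairing i G"
          "(a, b') \<in> ?f ` colour_pairing c G"
          unfolding p by (auto simp: pair_step_def)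
        from m(1) obtain \<pi> where \<pi>: "(a, b) = ?f \<pi>" "\<pi> \<in> colour_pairing i G" by (rule imageE)
        from m(2) obtain \<pi>' where \<pi>': "(a', b') = ?f \<pi>'" "\<pi>' \<in> colour_pairing i G" by (rule imageE)
        from m(3) obtain \<rho> where \<rho>: "(a, b') = ?f \<rho>" "\<rho> \<in> colour_pairing c G" by (rule imageE)
        \<comment> \<open>The three preimages were chosen independently; injectivity of
          \<open>F\<close> shows that their shared ends agree.\<close>
        have "F (fst \<rho>) = F (fst \<pi>)" "F (snd \<rho>) = F (snd \<pi>')"
          using \<pi>(1) \<pi>'(1) \<rho>(1) by (metis fst_conv fst_map_prod, metis snd_conv snd_map_prod)
        then have "fst \<rho> = fst \<pi>" "snd \<rho> = snd \<pi>'"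
          using inj V \<pi>(2) \<pi>'(2) \<rho>(2) by (meson inj_onD)+
        then have "(fst \<pi>, snd \<pi>') \<in> colour_pairing c G" using \<rho>(2) by (metis prod.collapse)
        then have "(\<pi>, \<pi>') \<in> pair_step i G c" using \<pi>(2) \<pi>'(2) by (simp add: pair_step_def)
        then show "((a, b), (a', b')) \<in> map_prod ?f ?f ` pair_step i G c"
          using \<pi>(1) \<pi>'(1) by (intro image_eqI[of _ _ "(\<pi>, \<pi>')"]) simp_all
      qed
    qed
    ultimately show ?R by blast
  qed
  show "cgraph_isomorphic G H" if ?R
  proof -
    from that obtain f where f: "bij_betw f (colour_pairing i G) (colour_pairing i H)"
      and step: "\<And>c. c \<in> {0..D} - {i} \<Longrightarrow> map_prod f f ` pair_step i G c = pair_step i H c" by blast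
    have im: "f ` colour_pairing i G = colour_pairing i H" and inj: "inj_on f (colour_pairing i G)"
      using f by (auto simp: bij_betw_def)
    \<comment> \<open>A vertex goes to the end of the same colour class in the image of its own
      pair.\<close>
    define F where "F v = (if v \<in> black G then fst (f (inv_into (colour_pairing i G) fst v))
      else snd (f (inv_into (colour_pairing i G) snd v)))" for v
    have Fb: "F (fst \<pi>) = fst (f \<pi>)" and Fw: "F (snd \<pi>) = snd (f \<pi>)" if \<pi>: "\<pi> \<in> colour_pairing i G" for \<pi>
    proof -
      have "fst \<pi> \<in> black G" "snd \<pi> \<notin> black G"
        using \<pi> G.fst_pairs G.snd_pairs G.disjoint by blast+
      then show "F (fst \<pi>) = fst (f \<pi>)" "F (snd \<pi>) = snd (f \<pi>)"
        unfolding F_def using inv_into_f_f[OF G.inj_fst \<pi>] inv_into_f_f[OF G.inj_snd \<pi>] by simp_all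
    qed
    have Fbl: "F ` black G = black H" and Fwh: "F ` white G = white H"
      unfolding G.fst_pairs[symmetric] G.snd_pairs[symmetric] H.fst_pairs[symmetric] H.snd_pairs[symmetric]
        im[symmetric] image_image using Fb Fw by simp_all
    have "inj_on F (black G)" unfolding G.fst_pairs[symmetric]
    proof (rule inj_onI, clarify)
      fix a b a' b' assume 1: "(a, b) \<in> colour_pairing i G" "(a', b') \<in> colour_pairing i G"
        "F (fst (a, b)) = F (fst (a', b'))"
      then have "f (a, b) = f (a', b')" using Fb im inj_onD[OF H.inj_fst] by (metis image_eqI)
      then show "fst (a, b) = fst (a', b')" using inj_onD[OF inj] 1 by metis
    qed
    moreover have "inj_on F (white G)" unfolding G.snd_pairs[symmetric]
    proof (rule inj_onI, clarify)
      fix a b a' b' assume 1: "(a, b) \<in> colour_pairing i G" "(a', b') \<in> colour_pairing i G"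
        "F (snd (a, b)) = F (snd (a', b'))"
      then have "f (a, b) = f (a', b')" using Fw im inj_onD[OF H.inj_snd] by (metis image_eqI)
      then show "snd (a, b) = snd (a', b')" using inj_onD[OF inj] 1 by metis
    qed
    ultimately have "bij_betw F (black G \<union> white G) (black H \<union> white H)"
      using Fbl Fwh H.disjoint by (intro bij_betw_combine) (auto simp: bij_betw_def)
    moreover have "map_prod F F ` colour_pairing c G = colour_pairing c H" for c
    proof -
      \<comment> \<open>The claim is for every natural number: colour \<open>i\<close> is handled by
        \<open>f\<close> itself, and beyond \<open>D\<close> both pairings are empty.\<close>
      consider "c = i" | "c > D" | "c \<in> {0..D} - {i}" by fastforce
      then show ?thesis
      proof cases
        case 1
        have "map_prod F F ` colour_pairing i G = f ` colour_pairing i G"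
          using Fb Fw by (intro image_cong) (auto simp: prod_eq_iff)
        then show ?thesis using im 1 by simp
      next
        case 2
        then show ?thesis using G.colour_pairing_le[of _ c] H.colour_pairing_le[of _ c] by fastforce
      next
        case 3
        have "map_prod F F ` colour_pairing c G =
            (\<lambda>(\<pi>, \<pi>'). (fst \<pi>, snd \<pi>')) ` map_prod f f ` pair_step i G c"
          unfolding G.colour_pairing_step image_image
          by (intro image_cong) (auto simp: pair_step_def Fb[symmetric] Fw[symmetric] simp del: fst_conv snd_conv)
        then show ?thesis unfolding step[OF 3] H.colour_pairing_step[symmetric] .
      qed
    qed
    ultimately show ?thesis unfolding iff using Fbl Fwh by blast
  qed
qed

lemma colours_nonempty:
  fixes D i :: nat
  assumes "D \<ge> 1"
  shows "{0..D} - {i} \<noteq> {}"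
proof -
  have "(if i = 0 then 1 else 0) \<in> {0..D} - {i}" using assms by auto
  then show ?thesis by blast
qed

text \<open>Read from right to left this makes the map well defined on classes, from left to right
  it makes it injective there.\<close>

lemma Psi_colour_isomorphic_iff:
  assumes "paired_graph q D G i" "paired_graph q D H i" "D \<ge> 1"
  shows "smap_isomorphic (Psi_colour D i G) (Psi_colour D i H) \<longleftrightarrow> cgraph_isomorphic G H"
proof -
  interpret G: paired_graph q D G i by (rule assms(1))
  interpret H: paired_graph q D H i by (rule assms(2))
  note C = colours_nonempty[OF assms(3)]
  show ?thesis
    unfolding G.Psi_colour_canonical H.Psi_colour_canonical
      canonical_map_isomorphic_iff[OF G.map_data_pairs H.map_data_pairs C]
      data_isomorphic_iff_step[OF G.map_data_pairs H.map_data_pairs]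
      cgraph_isomorphic_iff_pair_step[OF assms(1,2)]
    using G.data_step_pairs H.data_step_pairs by simp
qed

section \<open>Reconstruction of a coloured graph\<close>

text \<open>Each point of \<open>\<Omega>\<close> is split into a black and a white copy joined by
  an edge of colour \<open>i\<close>. The other edges follow the permutations, with those of colour
  0 at marked points left out. Infinite types leave room for all names.\<close>

lemma map_data_realised:
  fixes \<Omega> :: "'a set"
  assumes d: "map_data q ({0..D} - {i}) \<Omega> \<sigma> K" and i: "i \<le> D" "q > 0 \<longrightarrow> i \<noteq> 0"
  shows "\<exists>G :: ('v::infinite, 'e::infinite) cgraph. G \<in> coloured_graphs q D \<and>
    (\<exists>u. bij_betw u \<Omega> (colour_pairing i G) \<and>
      (\<forall>c\<in>{0..D} - {i}. map_prod u u ` data_step \<Omega> \<sigma> K c = pair_step i G c))"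
proof -
  let ?C = "{0..D} - {i}"
  \<comment> \<open>The identity at colour \<open>i\<close> produces the edges that join the two
    copies of a point.\<close>
  define s where "s c = (if c = i then id else \<sigma> c)" for c
  define E where "E = {(c, x). c \<le> D \<and> x \<in> \<Omega> \<and> \<not> (c = 0 \<and> x \<in> K)}"
  have fin: "finite \<Omega>" and ne: "\<Omega> \<noteq> {}" and K: "K \<subseteq> \<Omega>" "0 \<notin> ?C \<Longrightarrow> K = {}" "card K = q"
    and bij: "\<And>c. c \<in> ?C \<Longrightarrow> bij_betw (\<sigma> c) \<Omega> \<Omega>"
    using d by (auto simp: map_data_def)
  have s: "s c ` \<Omega> = \<Omega>" "inj_on (s c) \<Omega>" if "c \<le> D" for c
    using bij[of c] that by (auto simp: s_def bij_betw_def)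
  have sx: "s c x \<in> \<Omega>" if "c \<le> D" "x \<in> \<Omega>" for c x using s(1)[OF that(1)] that(2) by blast
  \<comment> \<open>All edges of colour \<open>i\<close> are present: if \<open>i = 0\<close>,
    nothing is marked.\<close>
  have Ei: "(i, x) \<in> E \<longleftrightarrow> x \<in> \<Omega>" for x using i K(2) by (auto simp: E_def)
  have finE: "finite E" by (rule finite_subset[of _ "{0..D} \<times> \<Omega>"]) (auto simp: E_def fin)
  obtain \<phi> :: "'a \<times> bool \<Rightarrow> 'v" where \<phi>: "inj_on \<phi> (\<Omega> \<times> UNIV)"
    using arb_inj_on_finite_infinite[of "\<Omega> \<times> (UNIV :: bool set)"] fin by auto
  obtain \<psi> :: "nat \<times> 'a \<Rightarrow> 'e" where \<psi>: "inj_on \<psi> E"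
    using arb_inj_on_finite_infinite[OF finE] by blast
  define bl where "bl x = \<phi> (x, False)" for x
  define wh where "wh x = \<phi> (x, True)" for x
  have bl: "inj_on bl \<Omega>" and wh: "inj_on wh \<Omega>" and blwh: "\<And>x y. x \<in> \<Omega> \<Longrightarrow> y \<in> \<Omega> \<Longrightarrow> bl x \<noteq> wh y"
    using \<phi> by (auto simp: bl_def wh_def inj_on_def)
  define k where "k = inv_into E \<psi>"
  have k: "k (\<psi> p) = p" if "p \<in> E" for p unfolding k_def by (rule inv_into_f_f[OF \<psi> that])
  define G :: "('v, 'e) cgraph" where "G = \<lparr>black = bl ` \<Omega>, white = wh ` \<Omega>, edges = \<psi> ` E,
    bend = (\<lambda>e. bl (snd (k e))), wend = (\<lambda>e. wh (s (fst (k e)) (snd (k e)))), colour = (\<lambda>e. fst (k e))\<rparr>"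
  have sel: "black G = bl ` \<Omega>" "white G = wh ` \<Omega>" "edges G = \<psi> ` E"
    and edge: "\<And>c x. (c, x) \<in> E \<Longrightarrow>
      bend G (\<psi> (c, x)) = bl x \<and> wend G (\<psi> (c, x)) = wh (s c x) \<and> colour G (\<psi> (c, x)) = c"
    using k by (auto simp: G_def)
  have P: "colour_pairing c G = (\<lambda>x. (bl x, wh (s c x))) ` {x. (c, x) \<in> E}" for c
  proof (intro set_eqI iffI)
    fix p assume "p \<in> colour_pairing c G"
    then obtain c' x where "(c', x) \<in> E" "p = (bl x, wh (s c' x))" "c' = c"
      using edge by (force simp: colour_pairing_def sel)
    then show "p \<in> (\<lambda>x. (bl x, wh (s c x))) ` {x. (c, x) \<in> E}" by blast
  next
    fix p assume "p \<in> (\<lambda>x. (bl x, wh (s c x))) ` {x. (c, x) \<in> E}"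
    then obtain x where x: "(c, x) \<in> E" "p = (bl x, wh (s c x))" by blast
    then have "\<psi> (c, x) \<in> edges G" by (auto simp: sel)
    then show "p \<in> colour_pairing c G" using edge[OF x(1)] unfolding x(2) colour_pairing_iff by blast
  qed
  have Pi: "colour_pairing i G = (\<lambda>x. (bl x, wh x)) ` \<Omega>" unfolding P Ei by (simp add: s_def)
  define u where "u x = (bl x, wh x)" for x
  have u: "bij_betw u \<Omega> (colour_pairing i G)"
    unfolding Pi u_def bij_betw_def using bl by (auto simp: inj_on_def)
  have step: "map_prod u u ` data_step \<Omega> \<sigma> K c = pair_step i G c" if c: "c \<in> ?C" for c
  proof (intro set_eqI iffI)
    have sc: "s c = \<sigma> c" and cD: "c \<le> D" using c by (auto simp: s_def)
    fix p
    {
      assume "p \<in> map_prod u u ` data_step \<Omega> \<sigma> K c"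
      then obtain x where x: "x \<in> \<Omega>" "\<not> (c = 0 \<and> x \<in> K)" "p = (u x, u (\<sigma> c x))"
        by (auto simp: data_step_def)
      have "\<sigma> c x \<in> \<Omega>" using sx[OF cD x(1)] sc by simp
      moreover have "(bl x, wh (\<sigma> c x)) \<in> colour_pairing c G"
        unfolding P sc using x cD by (auto simp: E_def)
      ultimately show "p \<in> pair_step i G c" using x by (simp add: pair_step_def Pi u_def)
    next
      assume "p \<in> pair_step i G c"
      then obtain x y where x: "x \<in> \<Omega>" "y \<in> \<Omega>" "p = (u x, u y)" "(bl x, wh y) \<in> colour_pairing c G"
        unfolding pair_step_def Pi u_def by auto
      then obtain z where z: "(c, z) \<in> E" "bl x = bl z" "wh y = wh (s c z)" unfolding P by auto
      then have "z \<in> \<Omega>" "\<not> (c = 0 \<and> z \<in> K)" by (auto simp: E_def)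
      then have "x = z" "y = \<sigma> c z"
        using z(2,3) x(1,2) inj_onD[OF bl] inj_onD[OF wh] sx[OF cD] sc by auto
      then have "(x, y) \<in> data_step \<Omega> \<sigma> K c"
        using \<open>z \<in> \<Omega>\<close> \<open>\<not> (c = 0 \<and> z \<in> K)\<close> by (auto simp: data_step_def)
      then show "p \<in> map_prod u u ` data_step \<Omega> \<sigma> K c" using x(3) by (metis image_eqI map_prod_simp)
    }
  qed
  have full: "{x. (c, x) \<in> E} = \<Omega>" if "c \<le> D" "c \<noteq> 0" for c using that by (auto simp: E_def)
  have zero: "{x. (0, x) \<in> E} = \<Omega> - K" by (auto simp: E_def)
  have dom: "Domain (colour_pairing c G) = bl ` {x. (c, x) \<in> E}"
    and ran: "Range (colour_pairing c G) = wh ` s c ` {x. (c, x) \<in> E}" for c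
    unfolding P by (auto simp: Domain_fst Range_snd image_image)
  have "G \<in> coloured_graphs q D"
  proof (rule coloured_graphsI)
    show "finite (black G)" "finite (white G)" "finite (edges G)" using fin finE by (simp_all add: sel)
    show "black G \<inter> white G = {}" using blwh by (auto simp: sel)
    show ends: "bend G e \<in> black G \<and> wend G e \<in> white G \<and> colour G e \<le> D" if "e \<in> edges G" for e
    proof -
      from that obtain c x where "(c, x) \<in> E" "e = \<psi> (c, x)" by (auto simp: sel)
      then show ?thesis using edge sx unfolding sel E_def by auto
    qed
    show "e = e'" if e: "e \<in> edges G" "e' \<in> edges G" "colour G e = colour G e'" "bend G e = bend G e'" for e e'
    proof -
      from e obtain c x c' x' where *: "(c, x) \<in> E" "e = \<psi> (c, x)" "(c', x') \<in> E" "e' = \<psi> (c', x')"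
        by (auto simp: sel)
      then have "c = c'" "bl x = bl x'" using e(3,4) edge by auto
      moreover have "x \<in> \<Omega>" "x' \<in> \<Omega>" using * by (auto simp: E_def)
      ultimately show ?thesis using * inj_onD[OF bl] by blast
    qed
    show "e = e'" if e: "e \<in> edges G" "e' \<in> edges G" "colour G e = colour G e'" "wend G e = wend G e'" for e e'
    proof -
      from e obtain c x c' x' where *: "(c, x) \<in> E" "e = \<psi> (c, x)" "(c', x') \<in> E" "e' = \<psi> (c', x')"
        by (auto simp: sel)
      then have c: "c = c'" "wh (s c x) = wh (s c' x')" using e(3,4) edge by auto
      moreover have x: "x \<in> \<Omega>" "x' \<in> \<Omega>" "c \<le> D" using * by (auto simp: E_def)
      ultimately have "s c x = s c x'" using inj_onD[OF wh] sx by blast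
      then show ?thesis using * c(1) x inj_onD[OF s(2)[OF x(3)]] by blast
    qed
    show "Domain (colour_pairing c G) = black G \<and> Range (colour_pairing c G) = white G"
      if "c \<le> D" "c \<noteq> 0" for c
      unfolding dom ran full[OF that] sel using s(1)[OF that(1)] by simp
    have "black G - Domain (colour_pairing 0 G) = bl ` K"
      unfolding dom zero sel using inj_on_image_set_diff[OF bl, of \<Omega> "\<Omega> - K"] K(1)
      by (simp add: double_diff)
    then show "card (black G - Domain (colour_pairing 0 G)) = q"
      using card_image[OF inj_on_subset[OF bl K(1)]] K(3) by simp
    \<comment> \<open>On the white side the uncovered vertices are the images of the marked points
      under \<open>s 0\<close>; injectivity gives the same number \<open>q\<close>.\<close>
    have "white G - Range (colour_pairing 0 G) = wh ` s 0 ` K"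
    proof -
      have "s 0 ` (\<Omega> - K) \<subseteq> \<Omega>" using s(1)[of 0] by auto
      then have "white G - Range (colour_pairing 0 G) = wh ` (s 0 ` \<Omega> - s 0 ` (\<Omega> - K))"
        unfolding ran zero sel s(1)[OF le0] using inj_on_image_set_diff[OF wh, of \<Omega> "s 0 ` (\<Omega> - K)"] by simp
      also have "s 0 ` \<Omega> - s 0 ` (\<Omega> - K) = s 0 ` K"
        using inj_on_image_set_diff[OF s(2)[OF le0], of \<Omega> "\<Omega> - K"] K(1) by (simp add: double_diff)
      finally show ?thesis .
    qed
    moreover have "card (wh ` s 0 ` K) = card K"
    proof -
      have "s 0 ` K \<subseteq> \<Omega>" using s(1)[of 0] K(1) by auto
      then show ?thesis
        using card_image[OF inj_on_subset[OF wh]] card_image[OF inj_on_subset[OF s(2)[OF le0] K(1)]] by simp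
    qed
    ultimately show "card (white G - Range (colour_pairing 0 G)) = q" using K(3) by simp
    show "cgraph_connected G"
    proof (subst cgraph_connected_iff, goal_cases)
      case 1 then show ?case using ends by blast
    next
      case 2
      have "S = black G \<union> white G" if S: "S \<subseteq> black G \<union> white G" "S \<noteq> {}"
        and cl: "\<forall>c b w. (b, w) \<in> colour_pairing c G \<longrightarrow> (b \<in> S \<longleftrightarrow> w \<in> S)" for S
      proof -
        \<comment> \<open>The edges of colour \<open>i\<close> put both copies of a point on the
          same side of a cut, so the black copies alone record it.\<close>
        define A where "A = {x \<in> \<Omega>. bl x \<in> S}"
        have bw: "bl x \<in> S \<longleftrightarrow> wh x \<in> S" if "x \<in> \<Omega>" for x
        proof -
          have "(bl x, wh x) \<in> colour_pairing i G" unfolding Pi using that by blast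
          then show ?thesis using cl by blast
        qed
        have "\<sigma> c ` A \<subseteq> A" if c: "c \<in> ?C" for c
        proof -
          have "x \<in> A \<longleftrightarrow> y \<in> A" if xy: "(x, y) \<in> data_step \<Omega> \<sigma> K c" for x y
          proof -
            have y: "y = s c x" and x: "x \<in> \<Omega>" "(c, x) \<in> E"
              using xy c by (auto simp: data_step_def s_def E_def)
            have "(bl x, wh y) \<in> colour_pairing c G" unfolding P y using x(2) by blast
            moreover have "y \<in> \<Omega>" unfolding y using sx c x(1) by simp
            ultimately show ?thesis using cl bw x(1) unfolding A_def by blast
          qed
          then have "\<forall>(x, y)\<in>data_step \<Omega> \<sigma> K c. x \<in> A \<longleftrightarrow> y \<in> A" by blast
          moreover have "A \<subseteq> \<Omega>" by (auto simp: A_def)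
          ultimately show ?thesis
            using partial_bijection.closed_iff_closure_fun_closed[OF partial_bijection_data_step[OF d c]
                map_data_closure[OF d c]] by blast
        qed
        moreover have "A \<noteq> {}" using S bw unfolding sel A_def by blast
        moreover have "A \<subseteq> \<Omega>" by (auto simp: A_def)
        ultimately have "A = \<Omega>" using d by (simp add: map_data_def)
        then have "bl x \<in> S \<and> wh x \<in> S" if "x \<in> \<Omega>" for x using that bw unfolding A_def by blast
        then show ?thesis using S(1) unfolding sel by blast
      qed
      then show ?case using ne by (simp add: sel)
    qed
  qed
  then show ?thesis using u step by blast
qed

section \<open>Surjectivity and passage to isomorphism classes\<close>

text \<open>The graph realising the normal form of \<open>M\<close> has the same unmarked steps as
  \<open>M\<close> up to relabelling, and these determine the map up to isomorphism.\<close>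

lemma Psi_colour_surj:
  fixes M :: "('w, 'n, 'm) smap"
  assumes M: "M \<in> stacked_maps q ({0..D} - {i})" and i: "i \<le> D" "q > 0 \<longrightarrow> i \<noteq> 0" and D: "D \<ge> 1"
  shows "\<exists>G :: ('v::infinite, 'e::infinite) cgraph. G \<in> coloured_graphs q D \<and> smap_isomorphic M (Psi_colour D i G)"
proof -
  note C = colours_nonempty[OF D]
  obtain \<sigma> K where d: "map_data q ({0..D} - {i}) (whites M) \<sigma> K"
    and M_iso: "smap_isomorphic M (canonical_map ({0..D} - {i}) (whites M) \<sigma> K)"
    using stacked_map_canonical[OF M] by blast
  obtain G :: "('v, 'e) cgraph" and u where G: "G \<in> coloured_graphs q D"
    and u: "bij_betw u (whites M) (colour_pairing i G)"
      "\<forall>c\<in>{0..D} - {i}. map_prod u u ` data_step (whites M) \<sigma> K c = pair_step i G c"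
    using map_data_realised[OF d i] by blast
  interpret paired_graph q D G i using G i by unfold_locales
  have "smap_isomorphic (canonical_map ({0..D} - {i}) (whites M) \<sigma> K) (Psi_colour D i G)"
    unfolding Psi_colour_canonical canonical_map_isomorphic_iff[OF d map_data_pairs C]
      data_isomorphic_iff_step[OF d map_data_pairs]
    using u data_step_pairs by auto
  then show ?thesis using smap_isomorphic_trans[OF stacked_mapsD[OF M] M_iso] G by blast
qed

theorem theorem2p3p2:
  fixes D q i :: nat
  assumes "D \<ge> 2" and "i \<in> {0..D}" and "q > 0 \<longrightarrow> i \<noteq> 0"
  shows "(Psi_colour D i :: ('v::infinite, 'e::infinite) cgraph \<Rightarrow> _)
           \<in> coloured_graphs q D \<rightarrow> stacked_maps q ({0..D} - {i}) \<and>
         (\<lambda>G :: ('v, 'e) cgraph. smap_iso_rel q ({0..D} - {i}) `` {Psi_colour D i G})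
           respects cgraph_iso_rel q D \<and>
         bij_betw
           (\<lambda>X :: ('v, 'e) cgraph set.
              \<Union>G\<in>X. smap_iso_rel q ({0..D} - {i}) `` {Psi_colour D i G})
           (coloured_graphs q D // cgraph_iso_rel q D)
           (stacked_maps q ({0..D} - {i}) // smap_iso_rel q ({0..D} - {i}))"
proof (intro conjI)
  let ?C = "{0..D} - {i}"
  let ?\<Psi> = "Psi_colour D i :: ('v, 'e) cgraph \<Rightarrow> _"
  let ?r = "cgraph_iso_rel q D :: (('v, 'e) cgraph \<times> _) set"
  let ?s = "smap_iso_rel q ?C ::
    (('v \<times> 'v, nat \<times> ('v \<times> 'v) set, nat \<times> ('v \<times> 'v)) smap \<times> _) set"
  let ?\<Phi> = "\<lambda>X. \<Union>G\<in>X. ?s `` {?\<Psi> G}"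
  note er = equiv_cgraph_iso_rel[of q D] and es = equiv_smap_iso_rel[of q ?C]
  have paired: "paired_graph q D G i" if "G \<in> coloured_graphs q D" for G :: "('v, 'e) cgraph"
    using that assms by unfold_locales auto
  have \<Psi>: "?\<Psi> G \<in> stacked_maps q ?C" if "G \<in> coloured_graphs q D" for G
    using paired_graph.Psi_colour_in_stacked_maps[OF paired[OF that]] .
  have iso: "(?\<Psi> G, ?\<Psi> H) \<in> ?s \<longleftrightarrow> (G, H) \<in> ?r"
    if "G \<in> coloured_graphs q D" "H \<in> coloured_graphs q D" for G H
    using that \<Psi> Psi_colour_isomorphic_iff[OF paired paired, of G H] assms(1)
    by (simp add: smap_iso_rel_def cgraph_iso_rel_def)
  show "?\<Psi> \<in> coloured_graphs q D \<rightarrow> stacked_maps q ?C" using \<Psi> by blast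
  show resp: "(\<lambda>G. ?s `` {?\<Psi> G}) respects ?r"
  proof (rule congruentI)
    fix G H assume GH: "(G, H) \<in> ?r"
    then have "(?\<Psi> G, ?\<Psi> H) \<in> ?s" using iso by (simp add: cgraph_iso_rel_def)
    then show "?s `` {?\<Psi> G} = ?s `` {?\<Psi> H}" by (rule equiv_class_eq[OF es])
  qed
  have \<Phi>: "?\<Phi> (?r `` {G}) = ?s `` {?\<Psi> G}" if "G \<in> coloured_graphs q D" for G
    by (rule UN_equiv_class[OF er resp that])
  show "bij_betw ?\<Phi> (coloured_graphs q D // ?r) (stacked_maps q ?C // ?s)"
    unfolding bij_betw_def
  proof
    show "inj_on ?\<Phi> (coloured_graphs q D // ?r)"
    proof (rule inj_onI)
      fix X Y assume X: "X \<in> coloured_graphs q D // ?r" and Y: "Y \<in> coloured_graphs q D // ?r"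
        and eq: "?\<Phi> X = ?\<Phi> Y"
      obtain G where G: "G \<in> coloured_graphs q D" "X = ?r `` {G}" using X by (rule quotientE)
      obtain H where H: "H \<in> coloured_graphs q D" "Y = ?r `` {H}" using Y by (rule quotientE)
      have "?s `` {?\<Psi> G} = ?s `` {?\<Psi> H}" using eq \<Phi>[OF G(1)] \<Phi>[OF H(1)] G(2) H(2) by simp
      then have "(?\<Psi> G, ?\<Psi> H) \<in> ?s" by (rule eq_equiv_class[OF _ es \<Psi>[OF H(1)]])
      then have "(G, H) \<in> ?r" using iso[OF G(1) H(1)] by simp
      then show "X = Y" unfolding G(2) H(2) by (rule equiv_class_eq[OF er])
    qed
    show "?\<Phi> ` (coloured_graphs q D // ?r) = stacked_maps q ?C // ?s"
    proof
      show "?\<Phi> ` (coloured_graphs q D // ?r) \<subseteq> stacked_maps q ?C // ?s"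
      proof
        fix Z assume "Z \<in> ?\<Phi> ` (coloured_graphs q D // ?r)"
        then obtain X where X: "Z = ?\<Phi> X" "X \<in> coloured_graphs q D // ?r" by (rule imageE)
        from X(2) obtain G where G: "G \<in> coloured_graphs q D" "X = ?r `` {G}" by (rule quotientE)
        show "Z \<in> stacked_maps q ?C // ?s"
          unfolding X(1) G(2) \<Phi>[OF G(1)] by (rule quotientI[OF \<Psi>[OF G(1)]])
      qed
      show "stacked_maps q ?C // ?s \<subseteq> ?\<Phi> ` (coloured_graphs q D // ?r)"
      proof
        fix Z assume "Z \<in> stacked_maps q ?C // ?s"
        \<comment> \<open>The representative already uses pairs of vertices as white vertices, but
          the graph is rebuilt from its abstract structure, so only an isomorphism with the image is
          obtained.\<close>
        then obtain M where M: "M \<in> stacked_maps q ?C" "Z = ?s `` {M}" by (rule quotientE)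
        from M(1) obtain G :: "('v, 'e) cgraph" where G: "G \<in> coloured_graphs q D" "smap_isomorphic M (?\<Psi> G)"
          using Psi_colour_surj[OF M(1)] assms by (metis atLeastAtMost_iff one_le_numeral order_trans)
        then have "(M, ?\<Psi> G) \<in> ?s" using M(1) \<Psi>[OF G(1)] by (simp add: smap_iso_rel_def)
        then have "Z = ?\<Phi> (?r `` {G})"
          unfolding M(2) \<Phi>[OF G(1)] by (rule equiv_class_eq[OF es])
        then show "Z \<in> ?\<Phi> ` (coloured_graphs q D // ?r)" using quotientI[OF G(1)] by (rule image_eqI)
      qed
    qed
  qed
qed

end
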